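(* Let $S=(S_1,\dots,S_d)$ and $T=(T_1,\dots,T_d)$ be absolutely continuous commuting row contractions which are both cyclic. Let $\Lambda\subset\mathbb B_d$ be an interpolating sequence and assume $\mathfrak v_0(\Lambda)\subset\mathrm{Ann}(S)=\mathrm{Ann}(T)$. Then $S$ is similar to $T$.
   Context: $\mathbb B_d$ is the open unit ball of $\mathbb C^d$; $\mathcal M_d$ is the multiplier algebra of the Drury–Arveson space $H^2_d$ (RKHS on $\mathbb B_d$ with kernel $(1-\langle z,w\rangle)^{-1}$) with its weak-$*$ topology. A commuting row contraction is a commuting $d$-tuple with $\sum T_jT_j^*\le I$; it is absolutely continuous if $p\mapsto p(T)$ extends to a weak-$*$ continuous unital homomorphism on $\mathcal M_d$, with kernel $\mathrm{Ann}(T)$. Cyclic: there is a vector $\xi$ with $\{p(T)\xi: p\text{ polynomial}\}$ dense. $\Lambda$ is interpolating if every bounded function on $\Lambda$ is the restriction of an element of $\mathcal M_d$. $\mathfrak v_0(\Lambda)=\{\psi\in\mathcal M_d:\psi|_\Lambda=0\}$. Similar: there is a bounded invertible $X$ with $XT_j=S_jX$ for all $j$. *)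

theory Defs
  imports "HOL-Analysis.Analysis"
begin

text \<open>A complex Hilbert space is a real Hilbert space (type class real_inner + complete_space)
  together with an isometric real-linear map J (multiplication by the imaginary unit) with J J = -1.
  The complex inner product is the unique sesquilinear form whose real part is the real inner product.\<close>

definition cstruct :: "('a::real_inner \<Rightarrow> 'a) \<Rightarrow> bool" where
  "cstruct J \<longleftrightarrow> linear J \<and> (\<forall>x. J (J x) = - x) \<and> (\<forall>x y. inner (J x) (J y) = inner x y)"

definition cscale :: "('a::real_vector \<Rightarrow> 'a) \<Rightarrow> complex \<Rightarrow> 'a \<Rightarrow> 'a" where
  "cscale J c x = Re c *\<^sub>R x + Im c *\<^sub>R J x"

definition cinner :: "('a::real_inner \<Rightarrow> 'a) \<Rightarrow> 'a \<Rightarrow> 'a \<Rightarrow> complex" where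
  "cinner J x y = Complex (inner x y) (- inner (J x) y)"

definition BH :: "('a::real_normed_vector \<Rightarrow> 'a) \<Rightarrow> ('a \<Rightarrow> 'a) set" where
  "BH J = {A. bounded_linear A \<and> (\<forall>x. A (J x) = J (A x))}"

definition bcl :: "('a::real_normed_vector \<Rightarrow> 'a) \<Rightarrow> ('b::real_normed_vector \<Rightarrow> 'b) \<Rightarrow> ('a \<Rightarrow> 'b) \<Rightarrow> bool" where
  "bcl J1 J2 X \<longleftrightarrow> bounded_linear X \<and> (\<forall>x. X (J1 x) = J2 (X x))"

text \<open>B is the (Hilbert space) adjoint of A.  For complex-linear A the adjoint with respect to
  the real inner product coincides with the complex adjoint.\<close>
definition is_adjoint :: "('a::real_inner \<Rightarrow> 'a) \<Rightarrow> ('a \<Rightarrow> 'a) \<Rightarrow> bool" where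
  "is_adjoint A B \<longleftrightarrow> (\<forall>x y. inner (A x) y = inner x (B y))"

definition commuting :: "('n \<Rightarrow> 'a \<Rightarrow> 'a) \<Rightarrow> bool" where
  "commuting T \<longleftrightarrow> (\<forall>i j. T i \<circ> T j = T j \<circ> T i)"

definition row_contraction :: "('a::real_inner \<Rightarrow> 'a) \<Rightarrow> ('n::finite \<Rightarrow> 'a \<Rightarrow> 'a) \<Rightarrow> bool" where
  "row_contraction J T \<longleftrightarrow> (\<forall>i. T i \<in> BH J) \<and>
     (\<exists>Ts. (\<forall>i. is_adjoint (T i) (Ts i)) \<and>
           (\<forall>x. (\<Sum>i\<in>UNIV. inner (T i (Ts i x)) x) \<le> inner x x))"

definition commuting_row_contraction :: "('a::real_inner \<Rightarrow> 'a) \<Rightarrow> ('n::finite \<Rightarrow> 'a \<Rightarrow> 'a) \<Rightarrow> bool" where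
  "commuting_row_contraction J T \<longleftrightarrow> commuting T \<and> row_contraction J T"

type_synonym 'n mindex = "'n \<Rightarrow> nat"

definition polys :: "('n mindex \<Rightarrow> complex) set" where
  "polys = {p. finite {\<alpha>. p \<alpha> \<noteq> 0}}"

definition monop :: "('n::finite \<Rightarrow> 'a \<Rightarrow> 'a) \<Rightarrow> 'n mindex \<Rightarrow> 'a \<Rightarrow> 'a" where
  "monop T \<alpha> = fold (\<lambda>i f. (T i ^^ \<alpha> i) \<circ> f) (SOME xs. distinct xs \<and> set xs = UNIV) id"

definition polycalc :: "('a::real_vector \<Rightarrow> 'a) \<Rightarrow> ('n::finite \<Rightarrow> 'a \<Rightarrow> 'a) \<Rightarrow> ('n mindex \<Rightarrow> complex) \<Rightarrow> 'a \<Rightarrow> 'a" where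
  "polycalc J T p = (\<lambda>x. \<Sum>\<alpha>\<in>{\<alpha>. p \<alpha> \<noteq> 0}. cscale J (p \<alpha>) (monop T \<alpha> x))"

definition cyclic :: "('a::{real_normed_vector} \<Rightarrow> 'a) \<Rightarrow> ('n::finite \<Rightarrow> 'a \<Rightarrow> 'a) \<Rightarrow> bool" where
  "cyclic J T \<longleftrightarrow> (\<exists>\<xi>. closure {polycalc J T p \<xi> | p. p \<in> polys} = UNIV)"

definition ball_d :: "(complex ^ 'n::finite) set" where
  "ball_d = {z. norm z < 1}"

definition zmon :: "complex ^ 'n::finite \<Rightarrow> 'n mindex \<Rightarrow> complex" where
  "zmon z \<alpha> = (\<Prod>i\<in>UNIV. (z $ i) ^ (\<alpha> i))"

text \<open>Expanding the kernel, 1/(1 - <z,w>) = sum_alpha (|alpha|!/alpha!) z^alpha conj(w)^alpha, so the RKHS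
  with this kernel is the space of power series sum c_alpha z^alpha with
  norm^2 = sum |c_alpha|^2 alpha!/|alpha|!.  Elements are represented by their coefficients.\<close>
definition daw :: "'n::finite mindex \<Rightarrow> real" where
  "daw \<alpha> = (\<Prod>i\<in>UNIV. fact (\<alpha> i)) / fact (\<Sum>i\<in>UNIV. \<alpha> i)"

definition DA :: "('n::finite mindex \<Rightarrow> complex) set" where
  "DA = {c. (\<lambda>\<alpha>. (cmod (c \<alpha>))\<^sup>2 * daw \<alpha>) summable_on UNIV}"

definition danorm2 :: "('n::finite mindex \<Rightarrow> complex) \<Rightarrow> real" where
  "danorm2 c = (\<Sum>\<^sub>\<infinity>\<alpha>. (cmod (c \<alpha>))\<^sup>2 * daw \<alpha>)"

definition dainner :: "('n::finite mindex \<Rightarrow> complex) \<Rightarrow> ('n mindex \<Rightarrow> complex) \<Rightarrow> complex" where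
  "dainner c e = (\<Sum>\<^sub>\<infinity>\<alpha>. c \<alpha> * cnj (e \<alpha>) * of_real (daw \<alpha>))"

definition ev :: "('n::finite mindex \<Rightarrow> complex) \<Rightarrow> complex ^ 'n \<Rightarrow> complex" where
  "ev c z = (\<Sum>\<^sub>\<infinity>\<alpha>. c \<alpha> * zmon z \<alpha>)"

text \<open>The multiplier algebra M_d: functions on the ball (normalised to vanish off the ball)
  multiplying H^2_d into itself.\<close>
definition multipliers :: "(complex ^ 'n::finite \<Rightarrow> complex) set" where
  "multipliers = {\<phi>. (\<forall>z. z \<notin> ball_d \<longrightarrow> \<phi> z = 0) \<and>
     (\<forall>c\<in>DA. \<exists>e\<in>DA. \<forall>z\<in>ball_d. ev e z = \<phi> z * ev c z)}"

definition multop :: "(complex ^ 'n::finite \<Rightarrow> complex) \<Rightarrow> ('n mindex \<Rightarrow> complex) \<Rightarrow> ('n mindex \<Rightarrow> complex)" where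
  "multop \<phi> c = (THE e. e \<in> DA \<and> (\<forall>z\<in>ball_d. ev e z = \<phi> z * ev c z))"

definition polyfun :: "('n::finite mindex \<Rightarrow> complex) \<Rightarrow> complex ^ 'n \<Rightarrow> complex" where
  "polyfun p z = (if z \<in> ball_d then (\<Sum>\<alpha>\<in>{\<alpha>. p \<alpha> \<noteq> 0}. p \<alpha> * zmon z \<alpha>) else 0)"

text \<open>Weak-* topology of M_d: M_d is a weak-* (= WOT) closed algebra of multiplication operators
  on H^2_d, and its weak-* topology is the relative sigma-weak topology, i.e. the weak topology
  induced by the normal functionals phi \<mapsto> sum_n <M_phi f_n, g_n> with sum ||f_n||^2, sum ||g_n||^2 finite.\<close>
definition weakstar_M :: "(complex ^ 'n::finite \<Rightarrow> complex) topology" where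
  "weakstar_M = topology_generated_by
     {{\<phi>\<in>multipliers. (\<Sum>\<^sub>\<infinity>n. dainner (multop \<phi> (f n)) (g n)) \<in> U} | f g U.
        (\<forall>n. f n \<in> DA \<and> g n \<in> DA) \<and> summable (\<lambda>n. danorm2 (f n)) \<and>
        summable (\<lambda>n. danorm2 (g n)) \<and> open U}"

definition weakstar_B :: "('a::real_inner \<Rightarrow> 'a) \<Rightarrow> ('a \<Rightarrow> 'a) topology" where
  "weakstar_B J = topology_generated_by
     {{A\<in>BH J. (\<Sum>\<^sub>\<infinity>n. cinner J (A (x n)) (y n)) \<in> U} | x y U.
        summable (\<lambda>n. (norm (x n))\<^sup>2) \<and> summable (\<lambda>n. (norm (y n))\<^sup>2) \<and> open U}"

definition ac_calculus :: "('a::real_inner \<Rightarrow> 'a) \<Rightarrow> ('n::finite \<Rightarrow> 'a \<Rightarrow> 'a)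
     \<Rightarrow> ((complex ^ 'n \<Rightarrow> complex) \<Rightarrow> ('a \<Rightarrow> 'a)) \<Rightarrow> bool" where
  "ac_calculus J T \<Phi> \<longleftrightarrow>
     (\<forall>\<phi>\<in>multipliers. \<Phi> \<phi> \<in> BH J) \<and>
     (\<forall>\<phi>\<in>multipliers. \<forall>\<psi>\<in>multipliers. \<Phi> (\<lambda>z. \<phi> z + \<psi> z) = (\<lambda>x. \<Phi> \<phi> x + \<Phi> \<psi> x)) \<and>
     (\<forall>\<phi>\<in>multipliers. \<forall>c. \<Phi> (\<lambda>z. c * \<phi> z) = (\<lambda>x. cscale J c (\<Phi> \<phi> x))) \<and>
     (\<forall>\<phi>\<in>multipliers. \<forall>\<psi>\<in>multipliers. \<Phi> (\<lambda>z. \<phi> z * \<psi> z) = \<Phi> \<phi> \<circ> \<Phi> \<psi>) \<and>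
     \<Phi> (\<lambda>z. if z \<in> ball_d then 1 else 0) = id \<and>
     (\<forall>p\<in>polys. \<Phi> (polyfun p) = polycalc J T p) \<and>
     continuous_map weakstar_M (weakstar_B J) \<Phi>"

definition absolutely_continuous :: "('a::real_inner \<Rightarrow> 'a) \<Rightarrow> ('n::finite \<Rightarrow> 'a \<Rightarrow> 'a) \<Rightarrow> bool" where
  "absolutely_continuous J T \<longleftrightarrow> commuting_row_contraction J T \<and> (\<exists>\<Phi>. ac_calculus J T \<Phi>)"

text \<open>Ann(T) = kernel of the (unique) weak-* continuous extension Phi.\<close>
definition Ann :: "((complex ^ 'n::finite \<Rightarrow> complex) \<Rightarrow> ('a::zero \<Rightarrow> 'a)) \<Rightarrow> (complex ^ 'n \<Rightarrow> complex) set" where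
  "Ann \<Phi> = {\<phi>\<in>multipliers. \<Phi> \<phi> = (\<lambda>x. 0)}"

definition interpolating :: "(complex ^ 'n::finite) set \<Rightarrow> bool" where
  "interpolating \<Lambda> \<longleftrightarrow> (\<forall>f :: complex ^ 'n \<Rightarrow> complex. bounded (f ` \<Lambda>) \<longrightarrow>
      (\<exists>\<phi>\<in>multipliers. \<forall>z\<in>\<Lambda>. \<phi> z = f z))"

definition v0 :: "(complex ^ 'n::finite) set \<Rightarrow> (complex ^ 'n \<Rightarrow> complex) set" where
  "v0 \<Lambda> = {\<psi>\<in>multipliers. \<forall>z\<in>\<Lambda>. \<psi> z = 0}"

definition similar :: "('a::real_normed_vector \<Rightarrow> 'a) \<Rightarrow> ('n \<Rightarrow> 'a \<Rightarrow> 'a)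
     \<Rightarrow> ('b::real_normed_vector \<Rightarrow> 'b) \<Rightarrow> ('n \<Rightarrow> 'b \<Rightarrow> 'b) \<Rightarrow> bool" where
  "similar J1 S J2 T \<longleftrightarrow> (\<exists>X Y. bcl J2 J1 X \<and> bcl J1 J2 Y \<and> X \<circ> Y = id \<and> Y \<circ> X = id \<and>
      (\<forall>j. X \<circ> T j = S j \<circ> X))"

end

theory Submission
  imports Defs "HOL-Complex_Analysis.Cauchy_Integral_Formula"
begin

text \<open>
  Since functions in \<open>v0 \<Lambda>\<close> act as zero, the functional calculus factors through the bounded
  functions on \<open>\<Lambda>\<close>, and every subset of \<open>\<Lambda>\<close> yields an idempotent. A gliding hump argument of
  Bade and Curtis shows that an algebra seminorm on the bounded functions is uniformly bounded on
  indicators. It is used twice: for the operator norm it bounds the idempotents uniformly, and for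
  the multiplier norm it gives interpolants of the indicators of cofinite sets that are bounded and
  hence have a weak-* limit point, which vanishes on \<open>\<Lambda>\<close>. By weak-* continuity a vector killed by
  all atoms \<open>{\<lambda>}\<close> is therefore zero. Uniform boundedness of the idempotents makes the norm
  equivalent to the square sum of the components in the atoms (choose signs), and cyclicity makes
  each atom at most one-dimensional. So \<open>S\<close> and \<open>T\<close> are both similar to the diagonal tuple on the
  square summable sequences over the points of \<open>\<Lambda>\<close> with nonzero atom, and these points are
  determined by the annihilator.
\<close>

section \<open>Uniform boundedness on indicators\<close>

text \<open>The idempotents that come from bounded functions on \<Lambda> are a priori only finitely
  additive: a part of the space living on the Stone-Cech remainder of \<Lambda> would be invisible
  to every atom. Operator bounds cannot exclude such a part. Weak-* continuity does, but a sequence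
  of interpolants has to be bounded in the multiplier norm before it has a weak-* limit; this is why
  the hump argument is run for two different norms.

  The usual source of an interpolation constant is the open mapping theorem for the restriction map.
  Here a constant is needed for indicators only, and the hump argument supplies it algebraically. It
  is stated for a relation \<open>R f K\<close> and not for a seminorm, because both seminorms are
  quotient seminorms, whose infimum need not be attained.

  Multipliers are treated through their power series coefficients: a coefficient of a product is a
  finite sum, so coefficientwise limits pass through products, and coefficientwise compactness is
  elementary.\<close>

text \<open>\<open>R f K\<close> is to be read as: \<open>f\<close> on \<open>L\<close> has a lift
  of bound \<open>K\<close>. If no bound works for all sets, unboundedness passes to a subset again
  and again and leaves disjoint rings whose indicators have no small bound. Totality then gives
  bounds to functions mixing infinitely many rings, and \<open>mult\<close> plays these against each
  other.\<close>

lemma indicators_uniformly_bounded: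
  fixes R :: "('z \<Rightarrow> complex) \<Rightarrow> real \<Rightarrow> bool"
  assumes tot: "\<And>f. bounded (f ` L) \<Longrightarrow> \<exists>K. R f K"
    and cong: "\<And>f g K. R f K \<Longrightarrow> (\<And>z. z \<in> L \<Longrightarrow> f z = g z) \<Longrightarrow> R g K"
    and nonneg: "\<And>f K. R f K \<Longrightarrow> 0 \<le> K"
    and mono: "\<And>f K K'. R f K \<Longrightarrow> K \<le> K' \<Longrightarrow> R f K'"
    and add: "\<And>f g K M. R f K \<Longrightarrow> R g M \<Longrightarrow> R (\<lambda>z. f z + g z) (K + M)"
    and mult: "\<And>f g K M. R f K \<Longrightarrow> R g M \<Longrightarrow> R (\<lambda>z. f z * g z) (K * M)"
    and scale: "\<And>f K c. R f K \<Longrightarrow> R (\<lambda>z. c * f z) (cmod c * K)"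
  shows "\<exists>K. \<forall>A. R (indicator A) K"
proof (rule ccontr)
  assume contra: "\<nexists>K. \<forall>A. R (indicator A) K"
  define big where "big A \<longleftrightarrow> (\<forall>K. \<exists>B\<subseteq>A. \<not> R (indicator B) K)" for A
  have totI: "\<exists>K. R (indicator A) K" for A
    by (rule tot) (auto intro!: boundedI[where B = 1] simp: indicator_def)
  have big_UNIV: "big UNIV"
    using contra by (auto simp: big_def)
  have step: "\<exists>D\<subseteq>A. big D \<and> \<not> R (indicator (A - D)) t" if "big A" for A t
  proof -
    obtain KA where KA: "R (indicator A) KA" using totI by blast
    \<comment> \<open>The surplus \<open>KA\<close> keeps \<open>t\<close> from bounding
      \<open>A - B\<close> as well, since its indicator is that of \<open>A\<close> minus that of
      \<open>B\<close>. A half that is big again is kept, and the other half becomes the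
      ring.\<close>
    obtain B where B: "B \<subseteq> A" "\<not> R (indicator B) (t + KA)"
      using \<open>big A\<close> by (auto simp: big_def)
    have n1: "\<not> R (indicator B) t"
      using B(2) mono nonneg[OF KA] by (smt (verit))
    have n2: "\<not> R (indicator (A - B)) t"
    proof
      assume "R (indicator (A - B)) t"
      from add[OF scale[OF this, of "-1"] KA] have "R (\<lambda>z. - 1 * indicator (A - B) z + indicator A z) (t + KA)"
        by simp
      then have "R (indicator B) (t + KA)"
        by (rule cong) (use B(1) in \<open>auto simp: indicator_def\<close>)
      with B(2) show False ..
    qed
    have "big B \<or> big (A - B)"
    proof (rule ccontr)
      assume "\<not> ?thesis"
      then obtain K1 K2 where K: "\<And>C. C \<subseteq> B \<Longrightarrow> R (indicator C) K1" "\<And>C. C \<subseteq> A - B \<Longrightarrow> R (indicator C) K2"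
        by (auto simp: big_def)
      have "R (indicator C) (K1 + K2)" if "C \<subseteq> A" for C
      proof -
        have "R (\<lambda>z. indicator (C \<inter> B) z + indicator (C - B) z) (K1 + K2)"
          by (rule add) (use that in \<open>auto intro!: K\<close>)
        then show ?thesis by (rule cong) (auto simp: indicator_def)
      qed
      then show False using \<open>big A\<close> by (auto simp: big_def)
    qed
    then show ?thesis
    proof
      assume "big B" then show ?thesis using n2 B(1) by blast
    next
      assume "big (A - B)"
      moreover have "A - (A - B) = B" using B(1) by blast
      ultimately show ?thesis using n1 by (metis Diff_subset)
    qed
  qed
  \<comment> \<open>The rings fill an infinite matrix. A bound \<open>Y < 2 ^ i\<close> of
    \<open>y\<close> would contradict the demand \<open>4 ^ (i + j)\<close>: undoing the weights
    costs \<open>2 ^ (i + j)\<close>, and the two factors are bounded by \<open>Y\<close> and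
    \<open>2 ^ j\<close>.\<close>
  define t :: "nat \<Rightarrow> real" where "t n = (case prod_decode n of (i, j) \<Rightarrow> 4 ^ (i + j))" for n
  have "\<exists>D. \<forall>n. big (D n) \<and> (D (Suc n) \<subseteq> D n \<and> \<not> R (indicator (D n - D (Suc n))) (t n))"
    by (rule dependent_nat_choice) (use big_UNIV step in blast)+
  then obtain D where D: "\<And>n. D (Suc n) \<subseteq> D n" "\<And>n. \<not> R (indicator (D n - D (Suc n))) (t n)"
    by blast
  define A where "A n = D n - D (Suc n)" for n
  have dec: "D n \<subseteq> D m" if "m \<le> n" for m n
    using that D(1) by (rule lift_Suc_antimono_le[of D, rotated])
  have disj: "z \<in> A m \<Longrightarrow> z \<in> A n \<Longrightarrow> m = n" for z m n
    using dec[of "Suc m" n] dec[of "Suc n" m] unfolding A_def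
    by (metis DiffE Suc_leI linorder_neqE_nat subsetD)
  define AA where "AA i j = A (prod_encode (i, j))" for i j
  have AA_disj: "i = i' \<and> j = j'" if "z \<in> AA i j" "z \<in> AA i' j'" for z i j i' j'
    using disj[of z "prod_encode (i, j)" "prod_encode (i', j')"] that by (auto simp: AA_def)
  have AA_R: "\<not> R (indicator (AA i j)) (4 ^ (i + j))" for i j
    using D(2)[of "prod_encode (i, j)"] by (simp add: AA_def A_def t_def)
  \<comment> \<open>\<open>h i\<close> spreads the weights \<open>2\<^sup>-\<^sup>j\<close> over row \<open>i\<close>, while \<open>y\<close> picks from row \<open>i\<close> the column adapted to a bound of \<open>h i\<close>;
    their product isolates one hump.\<close>
  define h where "h i z = (if \<exists>j. z \<in> AA i j then (1/2) ^ (THE j. z \<in> AA i j) else (0::complex))" for i z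
  have h_eq: "h i z = (1/2) ^ j" if "z \<in> AA i j" for i j z
    unfolding h_def using that AA_disj by (metis (mono_tags, lifting) the_equality)
  have hb: "cmod (h i z) \<le> 1" for i z
    by (simp add: h_def norm_power power_le_one)
  have "\<forall>i. \<exists>K. R (h i) K"
    using tot hb by (auto intro!: boundedI[where B = 1])
  then obtain K where K: "\<And>i. R (h i) (K i)" by metis
  have "\<exists>j. K i \<le> 2 ^ j" for i
    using real_arch_pow[of 2 "K i"] by (meson less_imp_le one_less_numeral_iff semiring_norm(76))
  then obtain j where j: "\<And>i. K i \<le> 2 ^ j i" by metis
  define y where "y z = (if \<exists>i. z \<in> AA i (j i) then (1/2) ^ (THE i. z \<in> AA i (j i)) else (0::complex))" for z
  have y_eq: "y z = (1/2) ^ i" if "z \<in> AA i (j i)" for i z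
    unfolding y_def using that AA_disj by (metis (mono_tags, lifting) the_equality)
  have y_0: "y z = 0" if "\<And>i. z \<notin> AA i (j i)" for z
    using that by (simp add: y_def)
  have h_0: "h i z = 0" if "\<And>j. z \<notin> AA i j" for i z
    using that by (simp add: h_def)
  have "\<exists>K. R y K"
    by (rule tot) (auto intro!: boundedI[where B = 1] simp: y_def norm_power power_le_one)
  then obtain Y where Y: "R y Y" by blast
  have yh: "2 ^ (i + j i) * (y z * h i z) = indicator (AA i (j i)) z" for i z
  proof (cases "z \<in> AA i (j i)")
    case True
    then show ?thesis using y_eq[OF True] h_eq[OF True]
      by (simp add: power_add power_one_over)
  next
    case False
    have "y z = 0 \<or> h i z = 0"
      using False AA_disj y_0 h_0 by metis
    then show ?thesis using False by auto
  qed
  have "2 ^ i \<le> Y" for i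
  proof (rule ccontr)
    assume "\<not> 2 ^ i \<le> Y"
    have "R (\<lambda>z. 2 ^ (i + j i) * (y z * h i z)) (cmod (2 ^ (i + j i)) * (Y * 2 ^ j i))"
      by (intro scale mult Y mono[OF K j])
    then have "R (indicator (AA i (j i))) (2 ^ (i + j i) * (Y * 2 ^ j i))"
      by (simp add: yh norm_power)
    moreover have "2 ^ (i + j i) * (Y * 2 ^ j i) \<le> 2 ^ (i + j i) * (2 ^ i * 2 ^ j i)"
      using \<open>\<not> 2 ^ i \<le> Y\<close> by (intro mult_left_mono mult_right_mono) auto
    moreover have "\<dots> = (2 * 2 :: real) ^ (i + j i)"
      unfolding power_mult_distrib by (simp add: power_add)
    ultimately have "R (indicator (AA i (j i))) (4 ^ (i + j i))"
      by (auto intro: mono)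
    then show False using AA_R by blast
  qed
  moreover obtain i :: nat where "Y < 2 ^ i"
    using real_arch_pow[of 2 Y] by auto
  ultimately show False by (meson not_le)
qed

section \<open>Square summable families and the Drury--Arveson space\<close>

text \<open>A bound on all finite sections, used in place of a norm, carries summability with it and
  passes directly to coordinatewise limits.\<close>

definition l2_norm_le :: "('i \<Rightarrow> complex) \<Rightarrow> real \<Rightarrow> bool" where
  "l2_norm_le a B \<longleftrightarrow> (\<forall>F. finite F \<longrightarrow> L2_set (\<lambda>i. cmod (a i)) F \<le> B)"

lemma l2_norm_leD: "l2_norm_le a B \<Longrightarrow> finite F \<Longrightarrow> L2_set (\<lambda>i. cmod (a i)) F \<le> B"
  by (simp add: l2_norm_le_def)

lemma l2_norm_le_nonneg: "l2_norm_le a B \<Longrightarrow> 0 \<le> B"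
  using l2_norm_leD[of a B "{}"] by simp

lemma l2_norm_le_member: "l2_norm_le a B \<Longrightarrow> cmod (a i) \<le> B"
  using l2_norm_leD[of a B "{i}"] by (simp add: L2_set_def)

lemma l2_norm_le_mono: "l2_norm_le a B \<Longrightarrow> B \<le> C \<Longrightarrow> l2_norm_le a C"
  by (force simp: l2_norm_le_def)

lemma l2_norm_le_add:
  assumes "l2_norm_le a B" "l2_norm_le b C"
  shows "l2_norm_le (\<lambda>i. a i + b i) (B + C)"
  unfolding l2_norm_le_def
proof (intro allI impI)
  fix F :: "'a set" assume F: "finite F"
  have "L2_set (\<lambda>i. cmod (a i + b i)) F \<le> L2_set (\<lambda>i. cmod (a i) + cmod (b i)) F"
    by (rule L2_set_mono) (auto intro: norm_triangle_ineq)
  also have "\<dots> \<le> L2_set (\<lambda>i. cmod (a i)) F + L2_set (\<lambda>i. cmod (b i)) F"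
    by (rule L2_set_triangle_ineq)
  also have "\<dots> \<le> B + C"
    using assms F by (intro add_mono l2_norm_leD)
  finally show "L2_set (\<lambda>i. cmod (a i + b i)) F \<le> B + C" .
qed

lemma l2_norm_le_scale:
  assumes "l2_norm_le a B"
  shows "l2_norm_le (\<lambda>i. k * a i) (cmod k * B)"
  unfolding l2_norm_le_def
proof (intro allI impI)
  fix F :: "'a set" assume F: "finite F"
  have "L2_set (\<lambda>i. cmod (k * a i)) F = cmod k * L2_set (\<lambda>i. cmod (a i)) F"
    by (simp add: norm_mult L2_set_right_distrib)
  also have "\<dots> \<le> cmod k * B"
    using assms F by (intro mult_left_mono l2_norm_leD) auto
  finally show "L2_set (\<lambda>i. cmod (k * a i)) F \<le> cmod k * B" .
qed

lemma l2_norm_le_limit: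
  assumes "\<And>m. l2_norm_le (a m) B" and "\<And>i. (\<lambda>m. a m i) \<longlonglongrightarrow> b i"
  shows "l2_norm_le b B"
  unfolding l2_norm_le_def
proof (intro allI impI)
  fix F :: "'a set" assume F: "finite F"
  have "(\<lambda>m. L2_set (\<lambda>i. cmod (a m i)) F) \<longlonglongrightarrow> L2_set (\<lambda>i. cmod (b i)) F"
    unfolding L2_set_def by (intro tendsto_intros assms(2))
  then show "L2_set (\<lambda>i. cmod (b i)) F \<le> B"
    by (rule LIMSEQ_le_const2) (use assms(1) F in \<open>auto simp: l2_norm_le_def\<close>)
qed

lemma l2_norm_le_infsum:
  assumes "(\<lambda>i. (cmod (a i))\<^sup>2) summable_on UNIV"
  shows "l2_norm_le a (sqrt (\<Sum>\<^sub>\<infinity>i. (cmod (a i))\<^sup>2))"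
  unfolding l2_norm_le_def L2_set_def using finite_sum_le_infsum[OF assms] by auto

lemma l2_norm_le_iff_summable:
  "(\<exists>B. l2_norm_le a B) \<longleftrightarrow> (\<lambda>i. (cmod (a i))\<^sup>2) summable_on UNIV"
proof
  assume "\<exists>B. l2_norm_le a B"
  then obtain B where B: "l2_norm_le a B" by blast
  show "(\<lambda>i. (cmod (a i))\<^sup>2) summable_on UNIV"
  proof (rule nonneg_bdd_above_summable_on)
    show "bdd_above (sum (\<lambda>i. (cmod (a i))\<^sup>2) ` {F. F \<subseteq> UNIV \<and> finite F})"
    proof (rule bdd_aboveI2)
      fix F assume "F \<in> {F :: 'a set. F \<subseteq> UNIV \<and> finite F}"
      then have "sqrt (\<Sum>i\<in>F. (cmod (a i))\<^sup>2) \<le> B"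
        using l2_norm_leD[OF B, of F] by (simp add: L2_set_def)
      then show "(\<Sum>i\<in>F. (cmod (a i))\<^sup>2) \<le> B\<^sup>2"
        by (rule sqrt_le_D)
    qed
  qed auto
qed (use l2_norm_le_infsum in blast)

lemma sum_prod_le:
  assumes "l2_norm_le a B" "finite F"
  shows "(\<Sum>i\<in>F. cmod (a i * b i)) \<le> B * L2_set (\<lambda>i. cmod (b i)) F"
proof -
  have "(\<Sum>i\<in>F. cmod (a i * b i)) \<le> L2_set (\<lambda>i. cmod (a i)) F * L2_set (\<lambda>i. cmod (b i)) F"
    using L2_set_mult_ineq[of "\<lambda>i. cmod (a i)" "\<lambda>i. cmod (b i)" F] by (simp add: norm_mult)
  also have "\<dots> \<le> B * L2_set (\<lambda>i. cmod (b i)) F"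
    using assms by (intro mult_right_mono l2_norm_leD) auto
  finally show ?thesis .
qed

lemma l2_norm_le_prod_summable:
  assumes "l2_norm_le a B" "l2_norm_le b C"
  shows "(\<lambda>i. cmod (a i * b i)) summable_on UNIV" "(\<lambda>i. a i * b i) summable_on UNIV"
proof -
  have "bdd_above (sum (\<lambda>i. cmod (a i * b i)) ` {F. F \<subseteq> UNIV \<and> finite F})"
  proof (rule bdd_aboveI2)
    fix F assume "F \<in> {F :: 'a set. F \<subseteq> UNIV \<and> finite F}"
    then have F: "finite F" by auto
    have "(\<Sum>i\<in>F. cmod (a i * b i)) \<le> B * L2_set (\<lambda>i. cmod (b i)) F"
      using sum_prod_le[OF assms(1) F] .
    also have "\<dots> \<le> B * C"
      using l2_norm_leD[OF assms(2) F] l2_norm_le_nonneg[OF assms(1)] by (intro mult_left_mono)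
    finally show "(\<Sum>i\<in>F. cmod (a i * b i)) \<le> B * C" .
  qed
  then show "(\<lambda>i. cmod (a i * b i)) summable_on UNIV"
    by (intro nonneg_bdd_above_summable_on) auto
  then show "(\<lambda>i. a i * b i) summable_on UNIV"
    by (rule abs_summable_summable)
qed

lemma l2_norm_le_prod_infsum_le:
  assumes "l2_norm_le a B" "l2_norm_le b C"
  shows "cmod (\<Sum>\<^sub>\<infinity>i. a i * b i) \<le> B * C"
proof -
  have "cmod (\<Sum>\<^sub>\<infinity>i. a i * b i) \<le> (\<Sum>\<^sub>\<infinity>i. cmod (a i * b i))"
    using l2_norm_le_prod_summable(1)[OF assms] by (rule norm_infsum_bound)
  also have "\<dots> \<le> B * C"
  proof (rule infsum_le_finite_sums[OF l2_norm_le_prod_summable(1)[OF assms]])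
    fix F :: "'a set" assume F: "finite F"
    have "(\<Sum>i\<in>F. cmod (a i * b i)) \<le> B * L2_set (\<lambda>i. cmod (b i)) F"
      using sum_prod_le[OF assms(1) F] .
    also have "\<dots> \<le> B * C"
      using l2_norm_leD[OF assms(2) F] l2_norm_le_nonneg[OF assms(1)] by (intro mult_left_mono)
    finally show "(\<Sum>i\<in>F. cmod (a i * b i)) \<le> B * C" .
  qed
  finally show ?thesis .
qed

lemma l2_norm_le_tail:
  assumes "l2_norm_le b C" "0 < \<delta>"
  obtains F where "finite F" "l2_norm_le (\<lambda>i. if i \<in> F then 0 else b i) \<delta>"
proof -
  have s: "(\<lambda>i. (cmod (b i))\<^sup>2) summable_on UNIV"
    using assms(1) l2_norm_le_iff_summable by blast
  obtain F where F: "finite F" "dist (\<Sum>i\<in>F. (cmod (b i))\<^sup>2) (\<Sum>\<^sub>\<infinity>i. (cmod (b i))\<^sup>2) \<le> \<delta>\<^sup>2"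
    using infsum_finite_approximation[OF s, of "\<delta>\<^sup>2"] assms(2) by auto
  have "l2_norm_le (\<lambda>i. if i \<in> F then 0 else b i) \<delta>"
    unfolding l2_norm_le_def L2_set_def
  proof (intro allI impI)
    fix G :: "'a set" assume G: "finite G"
    have "(\<Sum>i\<in>G. (cmod (if i \<in> F then 0 else b i))\<^sup>2) = (\<Sum>i\<in>G - F. (cmod (b i))\<^sup>2)"
      by (rule sum.mono_neutral_cong_right) (use G in auto)
    also have "\<dots> = (\<Sum>i\<in>G \<union> F. (cmod (b i))\<^sup>2) - (\<Sum>i\<in>F. (cmod (b i))\<^sup>2)"
      using G F(1) sum_diff[of "G \<union> F" F "\<lambda>i. (cmod (b i))\<^sup>2"] by (simp add: Un_Diff)
    also have "\<dots> \<le> (\<Sum>\<^sub>\<infinity>i. (cmod (b i))\<^sup>2) - (\<Sum>i\<in>F. (cmod (b i))\<^sup>2)"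
      using G F(1) by (intro diff_right_mono finite_sum_le_infsum[OF s]) auto
    also have "\<dots> \<le> \<delta>\<^sup>2"
      using F(2) by (auto simp: dist_real_def)
    finally show "sqrt (\<Sum>i\<in>G. (cmod (if i \<in> F then 0 else b i))\<^sup>2) \<le> \<delta>"
      using assms(2) by (simp add: real_le_lsqrt)
  qed
  with F(1) show ?thesis using that by blast
qed

text \<open>Bounded coordinatewise convergence is weak convergence: the pairing splits into finitely
  many coordinates and a tail of \<open>b\<close>, which Cauchy-Schwarz makes small uniformly in
  \<open>m\<close>.\<close>

lemma l2_norm_le_weak_limit:
  assumes a: "\<And>m. l2_norm_le (a m) B" and lim: "\<And>i. (\<lambda>m. a m i) \<longlonglongrightarrow> l i" and b: "l2_norm_le b C"
  shows "(\<lambda>m. \<Sum>\<^sub>\<infinity>i. a m i * b i) \<longlonglongrightarrow> (\<Sum>\<^sub>\<infinity>i. l i * b i)"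
proof -
  have l: "l2_norm_le l B" using a lim by (rule l2_norm_le_limit)
  define d where "d m i = a m i + (-1) * l i" for m i
  have d: "l2_norm_le (d m) (2 * B)" for m
    using l2_norm_le_add[OF a[of m] l2_norm_le_scale[OF l, of "-1"]] by (simp add: d_def[abs_def])
  have B0: "0 \<le> B" using l2_norm_le_nonneg[OF l] .
  have "(\<lambda>m. \<Sum>\<^sub>\<infinity>i. d m i * b i) \<longlonglongrightarrow> 0"
  proof (rule LIMSEQ_I)
    fix r :: real assume r: "0 < r"
    \<comment> \<open>The differences have norm at most \<open>2 * B\<close>, so the tail
      contributes at most \<open>2 * B * \<delta>\<close>, which is at most \<open>r / 2\<close>;
      the \<open>+ 1\<close> covers \<open>B = 0\<close>.\<close>
    define \<delta> where "\<delta> = r / (4 * (B + 1))"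
    have \<delta>: "0 < \<delta>" using r B0 by (simp add: \<delta>_def)
    obtain F where F: "finite F" "l2_norm_le (\<lambda>i. if i \<in> F then 0 else b i) \<delta>"
      using l2_norm_le_tail[OF b \<delta>] by blast
    have "(\<lambda>m. \<Sum>i\<in>F. d m i * b i) \<longlonglongrightarrow> (\<Sum>i\<in>F. (l i + (-1) * l i) * b i)"
      unfolding d_def by (intro tendsto_intros lim)
    then have "(\<lambda>m. \<Sum>i\<in>F. d m i * b i) \<longlonglongrightarrow> 0" by simp
    from LIMSEQ_D[OF this, of "r/2"] r obtain M where
      M: "\<And>m. m \<ge> M \<Longrightarrow> cmod (\<Sum>i\<in>F. d m i * b i) < r / 2" by auto
    have "cmod (\<Sum>\<^sub>\<infinity>i. d m i * b i) < r" if "m \<ge> M" for m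
    proof -
      have eq: "d m i * b i = (if i \<in> F then d m i * b i else 0) + d m i * (if i \<in> F then 0 else b i)" for i
        by simp
      have hs: "((\<lambda>i. if i \<in> F then d m i * b i else 0) has_sum (\<Sum>i\<in>F. d m i * b i)) UNIV"
        by (rule has_sum_finite_neutralI[OF F(1)]) auto
      have split: "(\<Sum>\<^sub>\<infinity>i. d m i * b i) = (\<Sum>i\<in>F. d m i * b i) + (\<Sum>\<^sub>\<infinity>i. d m i * (if i \<in> F then 0 else b i))"
        by (subst eq) (rule infsumI[OF has_sum_add[OF hs has_sum_infsum[OF l2_norm_le_prod_summable(2)[OF d[of m] F(2)]]]])
      have "cmod (\<Sum>\<^sub>\<infinity>i. d m i * b i) \<le> cmod (\<Sum>i\<in>F. d m i * b i) + 2 * B * \<delta>"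
        unfolding split
        using l2_norm_le_prod_infsum_le[OF d[of m] F(2)] norm_triangle_ineq[of "\<Sum>i\<in>F. d m i * b i" "\<Sum>\<^sub>\<infinity>i. d m i * (if i \<in> F then 0 else b i)"]
        by linarith
      moreover have "2 * B * \<delta> \<le> r / 2"
        using r B0 by (simp add: \<delta>_def field_simps)
      ultimately show ?thesis using M[OF that] by linarith
    qed
    then show "\<exists>no. \<forall>n\<ge>no. norm ((\<Sum>\<^sub>\<infinity>i. d n i * b i) - 0) < r" by auto
  qed
  moreover have "(\<Sum>\<^sub>\<infinity>i. d m i * b i) = (\<Sum>\<^sub>\<infinity>i. a m i * b i) - (\<Sum>\<^sub>\<infinity>i. l i * b i)" for m
  proof -
    have "((\<lambda>i. a m i * b i + (-1) * (l i * b i)) has_sum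
        ((\<Sum>\<^sub>\<infinity>i. a m i * b i) + (-1) * (\<Sum>\<^sub>\<infinity>i. l i * b i))) UNIV"
      by (intro has_sum_add has_sum_cmult_right has_sum_infsum l2_norm_le_prod_summable(2)[OF a b] l2_norm_le_prod_summable(2)[OF l b])
    moreover have "(\<lambda>i. a m i * b i + (-1) * (l i * b i)) = (\<lambda>i. d m i * b i)"
      by (auto simp: d_def algebra_simps)
    ultimately show ?thesis by (auto dest: infsumI)
  qed
  ultimately show ?thesis
    by (simp add: LIM_zero_iff)
qed

section \<open>Drury-Arveson space: norm bounds, kernel vectors and weak limits\<close>

text \<open>Rescaling by the square root of the weight turns the coefficients into an ordinary
  square summable family.\<close>

definition DA_norm_le :: "('n::finite mindex \<Rightarrow> complex) \<Rightarrow> real \<Rightarrow> bool" where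
  "DA_norm_le c B \<longleftrightarrow> l2_norm_le (\<lambda>\<alpha>. c \<alpha> * of_real (sqrt (daw \<alpha>))) B"

lemma daw_pos: "0 < daw \<alpha>"
  by (simp add: daw_def prod_pos)

lemma DA_iff_DA_norm_le: "c \<in> DA \<longleftrightarrow> (\<exists>B. DA_norm_le c B)"
proof -
  have "(cmod (c \<alpha> * of_real (sqrt (daw \<alpha>))))\<^sup>2 = (cmod (c \<alpha>))\<^sup>2 * daw \<alpha>" for \<alpha>
    using daw_pos[of \<alpha>] by (simp add: norm_mult power_mult_distrib)
  then show ?thesis
    by (simp add: DA_norm_le_def l2_norm_le_iff_summable DA_def)
qed

lemma DA_norm_le_danorm2:
  assumes "c \<in> DA"
  shows "DA_norm_le c (sqrt (danorm2 c))"
proof -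
  have "(cmod (c \<alpha> * of_real (sqrt (daw \<alpha>))))\<^sup>2 = (cmod (c \<alpha>))\<^sup>2 * daw \<alpha>" for \<alpha>
    using daw_pos[of \<alpha>] by (simp add: norm_mult power_mult_distrib)
  then show ?thesis
    using assms l2_norm_le_infsum[of "\<lambda>\<alpha>. c \<alpha> * of_real (sqrt (daw \<alpha>))"]
    by (simp add: DA_norm_le_def DA_def danorm2_def)
qed

lemma DA_norm_le_imp_DA: "DA_norm_le c B \<Longrightarrow> c \<in> DA"
  using DA_iff_DA_norm_le by blast

lemma DA_norm_le_nonneg: "DA_norm_le c B \<Longrightarrow> 0 \<le> B"
  unfolding DA_norm_le_def by (rule l2_norm_le_nonneg)

lemma DA_norm_le_mono: "DA_norm_le c B \<Longrightarrow> B \<le> C \<Longrightarrow> DA_norm_le c C"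
  unfolding DA_norm_le_def by (rule l2_norm_le_mono)

lemma DA_norm_le_add: "DA_norm_le c B \<Longrightarrow> DA_norm_le d C \<Longrightarrow> DA_norm_le (\<lambda>\<alpha>. c \<alpha> + d \<alpha>) (B + C)"
  unfolding DA_norm_le_def using l2_norm_le_add by (fastforce simp: algebra_simps)

lemma DA_norm_le_scale: "DA_norm_le c B \<Longrightarrow> DA_norm_le (\<lambda>\<alpha>. k * c \<alpha>) (cmod k * B)"
  unfolding DA_norm_le_def using l2_norm_le_scale[of _ B k] by (fastforce simp: algebra_simps)

lemma DA_norm_le_limit:
  assumes "\<And>m. DA_norm_le (c m) B" and "\<And>\<alpha>. (\<lambda>m. c m \<alpha>) \<longlonglongrightarrow> d \<alpha>"
  shows "DA_norm_le d B"
  unfolding DA_norm_le_def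
  by (rule l2_norm_le_limit[where a = "\<lambda>m \<alpha>. c m \<alpha> * of_real (sqrt (daw \<alpha>))", OF assms(1)[unfolded DA_norm_le_def]]) (intro tendsto_intros assms(2))

lemma DA_norm_le_coeff: "DA_norm_le c B \<Longrightarrow> cmod (c \<alpha>) \<le> B / sqrt (daw \<alpha>)"
  using l2_norm_le_member[of "\<lambda>\<alpha>. c \<alpha> * of_real (sqrt (daw \<alpha>))" B \<alpha>] daw_pos[of \<alpha>]
  by (simp add: DA_norm_le_def norm_mult field_simps)

definition mdeg :: "'n::finite mindex \<Rightarrow> nat" where
  "mdeg \<alpha> = (\<Sum>i\<in>UNIV. \<alpha> i)"

lemma finite_mindex_le: "finite {\<alpha> :: 'n::finite mindex. \<alpha> \<le> \<gamma>}"
proof -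
  have "{\<alpha>. \<alpha> \<le> \<gamma>} = PiE UNIV (\<lambda>i. {..\<gamma> i})"
    by (auto simp: le_fun_def PiE_def extensional_def)
  then show ?thesis by (simp add: finite_PiE)
qed

lemma finite_mdeg: "finite {\<alpha> :: 'n::finite mindex. mdeg \<alpha> = k}"
  by (rule finite_subset[OF _ finite_mindex_le[of "\<lambda>_. k"]])
    (auto simp: mdeg_def le_fun_def intro!: member_le_sum)

lemma mdeg_upd: "mdeg (\<beta>(i := Suc (\<beta> i))) = Suc (mdeg \<beta>)"
  unfolding mdeg_def by (simp add: sum.remove[of UNIV i])

text \<open>\<open>1 / daw \<alpha>\<close> is the multinomial coefficient. The induction splits the
  factor \<open>Suc k\<close>, the sum of the exponents, over the variables; in the part for
  \<open>i\<close>, taking off one factor \<open>x i\<close> maps the monomials divisible by it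
  bijectively onto those of degree \<open>k\<close>.\<close>

lemma multinomial_theorem:
  fixes x :: "'n::finite \<Rightarrow> real"
  shows "(\<Sum>\<alpha> | mdeg \<alpha> = k. (\<Prod>i\<in>UNIV. x i ^ \<alpha> i) / daw \<alpha>) = (\<Sum>i\<in>UNIV. x i) ^ k"
proof (induction k)
  case 0
  have "{\<alpha> :: 'n mindex. mdeg \<alpha> = 0} = {\<lambda>_. 0}"
    by (auto simp: mdeg_def)
  then show ?case by (simp add: daw_def)
next
  case (Suc k)
  define m where "m \<alpha> = (\<Prod>i\<in>UNIV. x i ^ \<alpha> i)" for \<alpha> :: "'n mindex"
  define P where "P \<alpha> = (\<Prod>i\<in>UNIV. fact (\<alpha> i) :: real)" for \<alpha> :: "'n mindex"
  have P0: "P \<alpha> \<noteq> 0" for \<alpha> by (simp add: P_def)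
  have daw: "daw \<alpha> = P \<alpha> / fact (mdeg \<alpha>)" for \<alpha>
    by (simp add: daw_def P_def mdeg_def)
  have inner: "(\<Sum>\<alpha> | mdeg \<alpha> = Suc k. real (\<alpha> i) * (fact k / P \<alpha>) * m \<alpha>) = x i * (\<Sum>\<beta> | mdeg \<beta> = k. m \<beta> / daw \<beta>)" for i
  proof -
    have "(\<Sum>\<alpha> | mdeg \<alpha> = Suc k. real (\<alpha> i) * (fact k / P \<alpha>) * m \<alpha>)
        = (\<Sum>\<alpha> | mdeg \<alpha> = Suc k \<and> \<alpha> i > 0. real (\<alpha> i) * (fact k / P \<alpha>) * m \<alpha>)"
      by (rule sum.mono_neutral_right) (auto simp: finite_mdeg)
    also have "\<dots> = (\<Sum>\<beta> | mdeg \<beta> = k. x i * (m \<beta> / daw \<beta>))"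
    proof (rule sum.reindex_bij_witness[where i = "\<lambda>\<beta>. \<beta>(i := Suc (\<beta> i))" and j = "\<lambda>\<alpha>. \<alpha>(i := \<alpha> i - 1)"])
      fix \<alpha> :: "'n mindex" assume "\<alpha> \<in> {\<alpha>. mdeg \<alpha> = Suc k \<and> 0 < \<alpha> i}"
      then have \<alpha>: "mdeg \<alpha> = Suc k" "0 < \<alpha> i" by auto
      define \<beta> where "\<beta> = \<alpha>(i := \<alpha> i - 1)"
      have ab: "\<alpha> = \<beta>(i := Suc (\<beta> i))" using \<alpha>(2) by (auto simp: \<beta>_def)
      show "(\<alpha>(i := \<alpha> i - 1))(i := Suc ((\<alpha>(i := \<alpha> i - 1)) i)) = \<alpha>"
        using \<alpha>(2) by auto
      have deg: "mdeg \<beta> = k" using \<alpha>(1) mdeg_upd[of \<beta> i] ab by simp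
      then show "\<alpha>(i := \<alpha> i - 1) \<in> {\<beta>. mdeg \<beta> = k}" by (simp add: \<beta>_def)
      have "P \<alpha> = real (Suc (\<beta> i)) * P \<beta>"
        unfolding P_def ab by (simp add: prod.remove[of UNIV i] algebra_simps)
      moreover have "m \<alpha> = x i * m \<beta>"
        unfolding m_def ab by (simp add: prod.remove[of UNIV i])
      moreover have "real (\<alpha> i) = real (Suc (\<beta> i))"
        unfolding ab by simp
      ultimately show "x i * (m (\<alpha>(i := \<alpha> i - 1)) / daw (\<alpha>(i := \<alpha> i - 1))) = real (\<alpha> i) * (fact k / P \<alpha>) * m \<alpha>"
        unfolding \<beta>_def[symmetric] daw deg using P0[of \<beta>]
        by (simp add: field_simps del: of_nat_Suc)
    next
      fix \<beta> :: "'n mindex" assume "\<beta> \<in> {\<beta>. mdeg \<beta> = k}"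
      then show "(\<beta>(i := Suc (\<beta> i)))(i := (\<beta>(i := Suc (\<beta> i))) i - 1) = \<beta>"
        "\<beta>(i := Suc (\<beta> i)) \<in> {\<alpha>. mdeg \<alpha> = Suc k \<and> 0 < \<alpha> i}"
        by (auto simp: mdeg_upd)
    qed
    finally show ?thesis by (simp add: sum_distrib_left)
  qed
  have "(\<Sum>\<alpha> | mdeg \<alpha> = Suc k. m \<alpha> / daw \<alpha>) = (\<Sum>\<alpha> | mdeg \<alpha> = Suc k. \<Sum>i\<in>UNIV. real (\<alpha> i) * (fact k / P \<alpha>) * m \<alpha>)"
  proof (rule sum.cong[OF refl])
    fix \<alpha> :: "'n mindex" assume "\<alpha> \<in> {\<alpha>. mdeg \<alpha> = Suc k}"
    then have "(\<Sum>i\<in>UNIV. real (\<alpha> i)) = Suc k" "mdeg \<alpha> = Suc k"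
      by (auto simp: mdeg_def simp flip: of_nat_sum)
    then show "m \<alpha> / daw \<alpha> = (\<Sum>i\<in>UNIV. real (\<alpha> i) * (fact k / P \<alpha>) * m \<alpha>)"
      unfolding sum_distrib_right[symmetric] by (simp add: daw)
  qed
  also have "\<dots> = (\<Sum>i\<in>UNIV. x i * (\<Sum>\<beta> | mdeg \<beta> = k. m \<beta> / daw \<beta>))"
    by (subst sum.swap) (simp only: inner)
  also have "\<dots> = (\<Sum>i\<in>UNIV. x i) ^ Suc k"
    using Suc.IH by (simp add: m_def flip: sum_distrib_right)
  finally show ?case by (simp add: m_def)
qed

text \<open>Up to conjugation this is the kernel vector at \<open>z\<close>. Its squared norm,
  grouped by degree, is a geometric series with ratio the squared norm of \<open>z\<close>.\<close>

lemma kernel_l2_norm_le: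
  fixes z :: "complex ^ 'n::finite"
  assumes "z \<in> ball_d"
  shows "\<exists>C. l2_norm_le (\<lambda>\<alpha>. zmon z \<alpha> / of_real (sqrt (daw \<alpha>))) C"
proof -
  define s where "s = (\<Sum>i\<in>UNIV. (cmod (z $ i))\<^sup>2)"
  have s: "0 \<le> s" "s < 1"
  proof -
    have "norm z < 1" using assms by (simp add: ball_d_def)
    then have "sqrt s < 1" by (simp add: norm_vec_def L2_set_def s_def)
    then show "s < 1" by simp
  qed (simp add: s_def sum_nonneg)
  define q where "q \<alpha> = (cmod (zmon z \<alpha> / of_real (sqrt (daw \<alpha>))))\<^sup>2" for \<alpha> :: "'n mindex"
  have q: "q \<alpha> = (\<Prod>i\<in>UNIV. ((cmod (z $ i))\<^sup>2) ^ \<alpha> i) / daw \<alpha>" for \<alpha>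
    using daw_pos[of \<alpha>] unfolding q_def zmon_def
    by (simp add: norm_divide power_divide norm_power prod_power_distrib power_mult[symmetric] mult.commute flip: prod_norm)
  have deg: "(\<Sum>\<alpha> | mdeg \<alpha> = k. q \<alpha>) = s ^ k" for k
    unfolding q s_def by (rule multinomial_theorem)
  have "(\<Sum>\<alpha>\<in>F. q \<alpha>) \<le> 1 / (1 - s)" if F: "finite F" for F
  proof -
    obtain N where N: "\<And>\<alpha>. \<alpha> \<in> F \<Longrightarrow> mdeg \<alpha> < N"
      using finite_nat_set_iff_bounded[of "mdeg ` F"] F by auto
    have "(\<Sum>\<alpha>\<in>F. q \<alpha>) \<le> (\<Sum>\<alpha>\<in>(\<Union>k<N. {\<alpha>. mdeg \<alpha> = k}). q \<alpha>)"
      using N by (intro sum_mono2) (auto simp: finite_mdeg q_def)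
    also have "\<dots> = (\<Sum>k<N. \<Sum>\<alpha> | mdeg \<alpha> = k. q \<alpha>)"
      by (rule sum.UNION_disjoint) (auto simp: finite_mdeg)
    also have "\<dots> = (\<Sum>k<N. s ^ k)" by (simp add: deg)
    also have "\<dots> \<le> (\<Sum>k. s ^ k)"
      using s by (intro sum_le_suminf summable_geometric) auto
    also have "\<dots> = 1 / (1 - s)"
      using s by (intro suminf_geometric) auto
    finally show ?thesis .
  qed
  then have "q summable_on UNIV"
    by (intro nonneg_bdd_above_summable_on bdd_aboveI2) (auto simp: q_def)
  then show ?thesis unfolding q_def l2_norm_le_iff_summable .
qed

lemma ev_weighted: "c \<alpha> * zmon z \<alpha> = (c \<alpha> * of_real (sqrt (daw \<alpha>))) * (zmon z \<alpha> / of_real (sqrt (daw \<alpha>)))"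
  using daw_pos[of \<alpha>] by simp

lemma DA_ev_summable:
  assumes "c \<in> DA" "z \<in> ball_d"
  shows "(\<lambda>\<alpha>. c \<alpha> * zmon z \<alpha>) summable_on UNIV"
  using assms kernel_l2_norm_le[OF assms(2)] l2_norm_le_prod_summable(2)
  unfolding DA_iff_DA_norm_le DA_norm_le_def ev_weighted by blast

text \<open>Evaluation is the pairing with the kernel vector, so weak convergence applies.\<close>

lemma ev_limit:
  assumes "\<And>m. DA_norm_le (c m) B" and "\<And>\<alpha>. (\<lambda>m. c m \<alpha>) \<longlonglongrightarrow> d \<alpha>" and "z \<in> ball_d"
  shows "(\<lambda>m. ev (c m) z) \<longlonglongrightarrow> ev d z"
proof -
  obtain C where "l2_norm_le (\<lambda>\<alpha>. zmon z \<alpha> / of_real (sqrt (daw \<alpha>))) C"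
    using kernel_l2_norm_le[OF assms(3)] by blast
  then show ?thesis
    unfolding ev_def ev_weighted
    by (rule l2_norm_le_weak_limit[where a = "\<lambda>m \<alpha>. c m \<alpha> * of_real (sqrt (daw \<alpha>))", OF assms(1)[unfolded DA_norm_le_def], rotated]) (intro tendsto_intros assms(2))
qed

lemma dainner_limit:
  assumes "\<And>m. DA_norm_le (c m) B" and "\<And>\<alpha>. (\<lambda>m. c m \<alpha>) \<longlonglongrightarrow> d \<alpha>" and "g \<in> DA"
  shows "(\<lambda>m. dainner (c m) g) \<longlonglongrightarrow> dainner d g"
proof -
  obtain C where C: "l2_norm_le (\<lambda>\<alpha>. cnj (g \<alpha>) * of_real (sqrt (daw \<alpha>))) C"
    using assms(3) by (auto simp: DA_iff_DA_norm_le DA_norm_le_def l2_norm_le_def norm_mult)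
  have eq: "x * y * complex_of_real (daw \<alpha>) = (x * of_real (sqrt (daw \<alpha>))) * (y * of_real (sqrt (daw \<alpha>)))" for x y and \<alpha> :: "'a mindex"
    using daw_pos[of \<alpha>] by (simp flip: of_real_mult)
  show ?thesis
    unfolding dainner_def eq
    by (rule l2_norm_le_weak_limit[where a = "\<lambda>m \<alpha>. c m \<alpha> * of_real (sqrt (daw \<alpha>))", OF assms(1)[unfolded DA_norm_le_def] _ C]) (intro tendsto_intros assms(2))
qed

lemma dainner_le:
  assumes "DA_norm_le c B" "DA_norm_le g C"
  shows "cmod (dainner c g) \<le> B * C"
proof -
  have C: "l2_norm_le (\<lambda>\<alpha>. cnj (g \<alpha>) * of_real (sqrt (daw \<alpha>))) C"
    using assms(2) by (auto simp: DA_norm_le_def l2_norm_le_def norm_mult)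
  have eq: "x * y * complex_of_real (daw \<alpha>) = (x * of_real (sqrt (daw \<alpha>))) * (y * of_real (sqrt (daw \<alpha>)))" for x y and \<alpha> :: "'a mindex"
    using daw_pos[of \<alpha>] by (simp flip: of_real_mult)
  show ?thesis
    unfolding dainner_def eq
    by (rule l2_norm_le_prod_infsum_le[OF assms(1)[unfolded DA_norm_le_def] C])
qed

section \<open>Uniqueness of power series coefficients on the ball\<close>

lemma powser_eq_0_imp_coeff_0:
  fixes a :: "nat \<Rightarrow> complex"
  assumes "\<And>t. cmod t < 1 \<Longrightarrow> (\<lambda>n. a n * t ^ n) sums 0"
  shows "a n = 0"
proof (rule ccontr)
  assume n: "a n \<noteq> 0"
  \<comment> \<open>The identity theorem \<open>powser_0_nonzero\<close> asks for a nonzero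
    coefficient of positive index; multiplying the series by \<open>t\<close> moves index
    \<open>n\<close> to \<open>Suc n\<close>.\<close>
  have a: "(\<lambda>n. (case n of 0 \<Rightarrow> 0 | Suc m \<Rightarrow> a m) * t ^ n) sums 0" if "cmod t < 1" for t
  proof -
    have "(\<lambda>n. t * (a n * t ^ n)) sums (t * 0)"
      using assms[OF that] by (rule sums_mult)
    then have "(\<lambda>n. (case Suc n of 0 \<Rightarrow> 0 | Suc m \<Rightarrow> a m) * t ^ Suc n) sums 0"
      by (simp add: algebra_simps)
    then show ?thesis by (subst (asm) sums_Suc_iff) simp
  qed
  show False
  proof (rule powser_0_nonzero[of 1 0 "\<lambda>n. case n of 0 \<Rightarrow> 0 | Suc m \<Rightarrow> a m" "\<lambda>_. 0" "Suc n"])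
    fix s :: real assume s: "0 < s" "\<And>z. z \<in> cball (0::complex) s - {0} \<Longrightarrow> (0::complex) \<noteq> 0"
    then show False using s(2)[of "of_real s"] by simp
  qed (use a n in auto)
qed

lemma zmon_scale: "zmon (\<chi> i. t * w $ i) \<alpha> = t ^ mdeg \<alpha> * zmon w \<alpha>"
  by (simp add: zmon_def mdeg_def power_mult_distrib prod.distrib power_sum)

text \<open>Along the disc t \<mapsto> t w the series becomes a power series in one variable, with
  the homogeneous parts at \<open>w\<close> as its coefficients.\<close>

lemma homogeneous_part_zero:
  fixes d :: "'n::finite mindex \<Rightarrow> complex"
  assumes d: "\<And>z. z \<in> ball_d \<Longrightarrow> ((\<lambda>\<alpha>. d \<alpha> * zmon z \<alpha>) has_sum 0) UNIV"
    and w: "w \<in> ball_d"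
  shows "(\<Sum>\<alpha> | mdeg \<alpha> = k. d \<alpha> * zmon w \<alpha>) = 0"
proof (rule powser_eq_0_imp_coeff_0[where a = "\<lambda>k. \<Sum>\<alpha> | mdeg \<alpha> = k. d \<alpha> * zmon w \<alpha>"])
  fix t :: complex assume t: "cmod t < 1"
  have "norm (\<chi> i. t * w $ i) \<le> norm w"
    unfolding norm_vec_def using t
    by (intro L2_set_mono) (auto simp: norm_mult intro: mult_left_le_one_le)
  then have "(\<chi> i. t * w $ i) \<in> ball_d" using w by (simp add: ball_d_def)
  from d[OF this] have "((\<lambda>\<alpha>. d \<alpha> * (t ^ mdeg \<alpha> * zmon w \<alpha>)) has_sum 0) UNIV"
    by (simp add: zmon_scale)
  then have "((\<lambda>(k, \<alpha>). d \<alpha> * (t ^ mdeg \<alpha> * zmon w \<alpha>)) has_sum 0) (SIGMA k:UNIV. {\<alpha>. mdeg \<alpha> = k})"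
    by (subst has_sum_reindex_bij_witness[where i = "\<lambda>\<alpha>. (mdeg \<alpha>, \<alpha>)" and j = snd and T = UNIV]) auto
  then have "((\<lambda>k. \<Sum>\<alpha> | mdeg \<alpha> = k. d \<alpha> * (t ^ mdeg \<alpha> * zmon w \<alpha>)) has_sum 0) UNIV"
    by (rule has_sum_SigmaD) (auto intro!: has_sum_finiteI finite_mdeg)
  then have "((\<lambda>k. (\<Sum>\<alpha> | mdeg \<alpha> = k. d \<alpha> * zmon w \<alpha>) * t ^ k) has_sum 0) UNIV"
    by (rule has_sum_cong[THEN iffD1, rotated]) (auto simp: sum_distrib_right intro!: sum.cong)
  then show "(\<lambda>k. (\<Sum>\<alpha> | mdeg \<alpha> = k. d \<alpha> * zmon w \<alpha>) * t ^ k) sums 0"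
    by (rule has_sum_imp_sums)
qed

text \<open>This keeps distinct monomials apart under the Kronecker substitution below, where
  exponents become digits.\<close>

lemma digits_unique:
  fixes a b :: "nat \<Rightarrow> nat"
  assumes "(\<Sum>i<n. a i * K ^ i) = (\<Sum>i<n. b i * K ^ i)"
    and "\<And>i. i < n \<Longrightarrow> a i < K" and "\<And>i. i < n \<Longrightarrow> b i < K"
    and "i < n"
  shows "a i = b i"
  using assms
proof (induction n arbitrary: a b i)
  case 0
  then show ?case by simp
next
  case (Suc n)
  have expand: "(\<Sum>i<Suc n. c i * K ^ i) = c 0 + K * (\<Sum>i<n. c (Suc i) * K ^ i)" for c
    unfolding sum.lessThan_Suc_shift sum_distrib_left by (simp add: algebra_simps)
  have eq: "a 0 + K * (\<Sum>i<n. a (Suc i) * K ^ i) = b 0 + K * (\<Sum>i<n. b (Suc i) * K ^ i)"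
    using Suc.prems(1) unfolding expand .
  have lt: "a 0 < K" "b 0 < K" using Suc.prems by auto
  have ab0: "a 0 = b 0"
    using arg_cong[OF eq, of "\<lambda>x. x mod K"] lt by simp
  have "(\<Sum>i<n. a (Suc i) * K ^ i) = (\<Sum>i<n. b (Suc i) * K ^ i)"
    using eq ab0 lt by simp
  then have "j < n \<Longrightarrow> a (Suc j) = b (Suc j)" for j
    using Suc.prems Suc.IH[of "\<lambda>i. a (Suc i)" "\<lambda>i. b (Suc i)" j] by simp
  then show ?case using ab0 Suc.prems(4) by (cases i) auto
qed

text \<open>The Kronecker substitution \<open>z\<^sub>i = t^((k+1)^i) / 2n\<close> separates the monomials of degree \<open>k\<close>.\<close>

lemma power_series_unique_0:
  fixes d :: "'n::finite mindex \<Rightarrow> complex"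
  assumes d: "\<And>z. z \<in> ball_d \<Longrightarrow> ((\<lambda>\<alpha>. d \<alpha> * zmon z \<alpha>) has_sum 0) UNIV"
  shows "d \<gamma> = 0"
proof -
  define k where "k = mdeg \<gamma>"
  define n where "n = CARD('n)"
  obtain \<iota> :: "nat \<Rightarrow> 'n" where \<iota>: "bij_betw \<iota> {..<n} UNIV"
    using ex_bij_betw_nat_finite[of "UNIV :: 'n set"] by (auto simp: n_def atLeast0LessThan)
  \<comment> \<open>On monomials of degree \<open>k\<close> every exponent is at most
    \<open>k\<close>, hence a digit in base \<open>Suc k\<close>, so \<open>e\<close> is injective
    there.\<close>
  define e where "e \<alpha> = (\<Sum>i<n. \<alpha> (\<iota> i) * (Suc k) ^ i)" for \<alpha> :: "'n mindex"
  have einj: "\<alpha> = \<beta>" if "mdeg \<alpha> = k" "mdeg \<beta> = k" "e \<alpha> = e \<beta>" for \<alpha> \<beta>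
  proof
    fix x
    obtain i where i: "i < n" "x = \<iota> i"
      using \<iota> by (auto simp: bij_betw_def)
    have "\<alpha> j < Suc k" "\<beta> j < Suc k" for j
      using that(1,2) unfolding mdeg_def less_Suc_eq_le
      by (metis UNIV_I finite member_le_sum zero_le)+
    with digits_unique[of "\<lambda>i. \<alpha> (\<iota> i)" "Suc k" n "\<lambda>i. \<beta> (\<iota> i)" i] that(3) i
    show "\<alpha> x = \<beta> x" by (simp add: e_def)
  qed
  define a where "a m = (\<Sum>\<alpha> | mdeg \<alpha> = k \<and> e \<alpha> = m. d \<alpha> * (1 / (2 * of_nat n)) ^ k)" for m
  define \<iota>' where "\<iota>' = the_inv_into {..<n} \<iota>"
  have \<iota>': "\<iota>' (\<iota> i) = i" if "i < n" for i
    using that \<iota> by (simp add: \<iota>'_def the_inv_into_f_f bij_betw_def)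
  have n0: "0 < n" by (simp add: n_def)
  have "a (e \<gamma>) = 0"
  proof (rule powser_eq_0_imp_coeff_0)
    fix t :: complex assume t: "cmod t < 1"
    \<comment> \<open>The factor \<open>1 / (2 * of_nat n)\<close> keeps the sum of the
      \<open>n\<close> coordinate moduli at most \<open>1 / 2\<close>, so \<open>w\<close> stays in
      the ball.\<close>
    define w :: "complex ^ 'n" where "w = (\<chi> x. (1 / (2 * of_nat n)) * t ^ (Suc k ^ \<iota>' x))"
    have "norm w \<le> (\<Sum>i\<in>UNIV. norm (w $ i))"
      unfolding norm_vec_def by (rule L2_set_le_sum) auto
    also have "\<dots> \<le> (\<Sum>i\<in>(UNIV::'n set). 1 / (2 * real n))"
      using t by (intro sum_mono) (auto simp: w_def norm_mult norm_divide norm_power intro!: divide_right_mono power_le_one)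
    also have "\<dots> = 1 / 2" using n0 by (simp add: n_def)
    finally have w: "w \<in> ball_d" by (simp add: ball_d_def)
    have zw: "zmon w \<alpha> = (1 / (2 * of_nat n)) ^ mdeg \<alpha> * t ^ e \<alpha>" for \<alpha>
    proof -
      have "zmon w \<alpha> = (1 / (2 * of_nat n)) ^ mdeg \<alpha> * (\<Prod>x\<in>UNIV. t ^ (\<alpha> x * Suc k ^ \<iota>' x))"
        by (simp only: zmon_def w_def vec_lambda_beta power_mult_distrib prod.distrib mdeg_def power_sum
            power_mult[symmetric] mult.commute)
      also have "(\<Prod>x\<in>UNIV. t ^ (\<alpha> x * Suc k ^ \<iota>' x)) = (\<Prod>i<n. t ^ (\<alpha> (\<iota> i) * Suc k ^ i))"
        using \<iota>' by (subst prod.reindex_bij_betw[OF \<iota>, symmetric]) auto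
      also have "\<dots> = t ^ e \<alpha>" by (simp only: e_def power_sum)
      finally show ?thesis .
    qed
    have fin: "finite {\<alpha> :: 'n mindex. mdeg \<alpha> = k}" by (rule finite_mdeg)
    define M where "M = Suc (Max (e ` {\<alpha>. mdeg \<alpha> = k}))"
    have M: "e \<alpha> < M" if "mdeg \<alpha> = k" for \<alpha>
      using that fin by (auto simp: M_def less_Suc_eq_le)
    have "(\<lambda>m. a m * t ^ m) sums (\<Sum>m<M. a m * t ^ m)"
    proof (rule sums_finite)
      fix m assume "m \<notin> {..<M}"
      then have "{\<alpha>. mdeg \<alpha> = k \<and> e \<alpha> = m} = {}" using M by force
      then show "a m * t ^ m = 0" by (simp only: a_def sum.empty) simp
    qed simp
    also have "(\<Sum>m<M. a m * t ^ m) = (\<Sum>m<M. \<Sum>\<alpha>\<in>{\<alpha> \<in> {\<alpha>. mdeg \<alpha> = k}. e \<alpha> = m}. d \<alpha> * zmon w \<alpha>)"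
      unfolding a_def sum_distrib_right by (intro sum.cong) (auto simp: zw)
    also have "\<dots> = (\<Sum>\<alpha> | mdeg \<alpha> = k. d \<alpha> * zmon w \<alpha>)"
      by (rule sum.group[OF fin]) (use M in auto)
    also have "\<dots> = 0"
      by (rule homogeneous_part_zero[OF d w])
    finally show "(\<lambda>m. a m * t ^ m) sums 0" .
  qed
  moreover have "{\<alpha>. mdeg \<alpha> = k \<and> e \<alpha> = e \<gamma>} = {\<gamma>}"
    using einj by (auto simp: k_def)
  ultimately show ?thesis using n0 by (simp add: a_def)
qed

lemma power_series_unique:
  fixes c d :: "'n::finite mindex \<Rightarrow> complex"
  assumes "\<And>z. z \<in> ball_d \<Longrightarrow> (\<lambda>\<alpha>. c \<alpha> * zmon z \<alpha>) summable_on UNIV"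
    and "\<And>z. z \<in> ball_d \<Longrightarrow> (\<lambda>\<alpha>. d \<alpha> * zmon z \<alpha>) summable_on UNIV"
    and "\<And>z. z \<in> ball_d \<Longrightarrow> ev c z = ev d z"
  shows "c = d"
proof
  fix \<gamma>
  have "c \<gamma> + (-1) * d \<gamma> = 0"
  proof (rule power_series_unique_0[where d = "\<lambda>\<gamma>. c \<gamma> + (-1) * d \<gamma>"])
    fix z :: "complex ^ 'n" assume z: "z \<in> ball_d"
    have "((\<lambda>\<alpha>. c \<alpha> * zmon z \<alpha> + (-1) * (d \<alpha> * zmon z \<alpha>)) has_sum (ev c z + (-1) * ev d z)) UNIV"
      unfolding ev_def by (intro has_sum_add has_sum_cmult_right has_sum_infsum assms z)
    then show "((\<lambda>\<alpha>. (c \<alpha> + (-1) * d \<alpha>) * zmon z \<alpha>) has_sum 0) UNIV"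
      using assms(3)[OF z] by (simp add: algebra_simps)
  qed
  then show "c \<gamma> = d \<gamma>" by simp
qed

section \<open>Cauchy products and products of functions\<close>

text \<open>Each coefficient is a finite sum, hence defined and continuous in the coefficients
  without any convergence assumption. The natural number subtraction is exact because
  \<open>\<alpha> \<le> \<gamma>\<close>.\<close>

definition cauchy_prod :: "('n::finite mindex \<Rightarrow> complex) \<Rightarrow> ('n mindex \<Rightarrow> complex) \<Rightarrow> 'n mindex \<Rightarrow> complex" where
  "cauchy_prod c f \<gamma> = (\<Sum>\<alpha> | \<alpha> \<le> \<gamma>. c \<alpha> * f (\<lambda>i. \<gamma> i - \<alpha> i))"

lemma zmon_add: "zmon z (\<lambda>i. \<alpha> i + \<beta> i) = zmon z \<alpha> * zmon z \<beta>"
  by (simp add: zmon_def power_add prod.distrib)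

text \<open>Unconditional summability of complex families is absolute, so the double family is
  summable and may be regrouped by the sum of the two indices.\<close>

lemma cauchy_prod_has_sum:
  assumes c: "(\<lambda>\<alpha>. c \<alpha> * zmon z \<alpha>) summable_on UNIV" and f: "(\<lambda>\<alpha>. f \<alpha> * zmon z \<alpha>) summable_on UNIV"
  shows "((\<lambda>\<gamma>. cauchy_prod c f \<gamma> * zmon z \<gamma>) has_sum (ev c z * ev f z)) UNIV"
proof -
  define u v where "u \<alpha> = c \<alpha> * zmon z \<alpha>" and "v \<alpha> = f \<alpha> * zmon z \<alpha>" for \<alpha>
  have nc: "(\<lambda>\<alpha>. norm (u \<alpha>)) summable_on UNIV"
    using c unfolding u_def[symmetric] by (rule summable_on_iff_abs_summable_on_complex[THEN iffD1])
  have nf: "(\<lambda>\<alpha>. norm (v \<alpha>)) summable_on UNIV"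
    using f unfolding v_def[symmetric] by (rule summable_on_iff_abs_summable_on_complex[THEN iffD1])
  have "(\<lambda>p. norm (u (fst p) * v (snd p))) summable_on UNIV \<times> UNIV"
  proof (rule summable_on_SigmaI[where g = "\<lambda>\<alpha>. norm (u \<alpha>) * (\<Sum>\<^sub>\<infinity>\<beta>. norm (v \<beta>))"])
    show "((\<lambda>\<beta>. norm (u (fst (\<alpha>, \<beta>)) * v (snd (\<alpha>, \<beta>)))) has_sum norm (u \<alpha>) * (\<Sum>\<^sub>\<infinity>\<beta>. norm (v \<beta>))) UNIV" for \<alpha>
      unfolding fst_conv snd_conv norm_mult by (rule has_sum_cmult_right[OF has_sum_infsum[OF nf]])
    show "(\<lambda>\<alpha>. norm (u \<alpha>) * (\<Sum>\<^sub>\<infinity>\<beta>. norm (v \<beta>))) summable_on UNIV"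
      by (rule summable_on_cmult_left[OF nc])
  qed (rule norm_ge_zero)
  then have "(\<lambda>p. u (fst p) * v (snd p)) summable_on UNIV \<times> UNIV"
    by (rule abs_summable_summable)
  then have abs: "(\<lambda>(\<alpha>, \<beta>). (c \<alpha> * zmon z \<alpha>) * (f \<beta> * zmon z \<beta>)) summable_on UNIV \<times> UNIV"
    by (simp only: u_def v_def case_prod_unfold)
  have "((\<lambda>(\<alpha>, \<beta>). (c \<alpha> * zmon z \<alpha>) * (f \<beta> * zmon z \<beta>)) has_sum (ev c z * ev f z)) (UNIV \<times> UNIV)"
  proof -
    have "((\<lambda>\<alpha>. (c \<alpha> * zmon z \<alpha>) * ev f z) has_sum (ev c z * ev f z)) UNIV"
      unfolding ev_def using c by (intro has_sum_cmult_left has_sum_infsum)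
    moreover have "((\<lambda>\<beta>. (c \<alpha> * zmon z \<alpha>) * (f \<beta> * zmon z \<beta>)) has_sum ((c \<alpha> * zmon z \<alpha>) * ev f z)) UNIV" for \<alpha>
      unfolding ev_def using f by (intro has_sum_cmult_right has_sum_infsum)
    ultimately show ?thesis
      using abs by (intro has_sum_SigmaI) auto
  qed
  moreover have Z: "zmon z \<alpha> * zmon z (\<lambda>i. \<gamma> i - \<alpha> i) = zmon z \<gamma>" if "\<alpha> \<le> \<gamma>" for \<alpha> \<gamma>
    using that by (subst zmon_add[symmetric]) (simp add: le_fun_def)
  have eq: "c \<alpha> * zmon z \<alpha> * (f (\<lambda>i. \<gamma> i - \<alpha> i) * zmon z (\<lambda>i. \<gamma> i - \<alpha> i)) = c \<alpha> * f (\<lambda>i. \<gamma> i - \<alpha> i) * zmon z \<gamma>" if "\<alpha> \<le> \<gamma>" for \<alpha> \<gamma>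
    unfolding Z[OF that, symmetric] by (simp only: mult_ac)
  have "((\<lambda>(\<gamma>, \<alpha>). (c \<alpha> * f (\<lambda>i. \<gamma> i - \<alpha> i)) * zmon z \<gamma>) has_sum (ev c z * ev f z)) (SIGMA \<gamma>:UNIV. {\<alpha>. \<alpha> \<le> \<gamma>})
      = ((\<lambda>(\<alpha>, \<beta>). (c \<alpha> * zmon z \<alpha>) * (f \<beta> * zmon z \<beta>)) has_sum (ev c z * ev f z)) (UNIV \<times> UNIV)"
  proof (rule has_sum_reindex_bij_witness[where i = "\<lambda>(\<alpha>, \<beta>). (\<lambda>i. \<alpha> i + \<beta> i, \<alpha>)" and j = "\<lambda>(\<gamma>, \<alpha>). (\<alpha>, \<lambda>i. \<gamma> i - \<alpha> i)"], goal_cases)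
    case (5 p)
    then show ?case
      by (cases p) (simp only: prod.case mem_Sigma_iff mem_Collect_eq eq)
  qed (auto simp: le_fun_def)
  ultimately have "((\<lambda>(\<gamma>, \<alpha>). (c \<alpha> * f (\<lambda>i. \<gamma> i - \<alpha> i)) * zmon z \<gamma>) has_sum (ev c z * ev f z)) (SIGMA \<gamma>:UNIV. {\<alpha>. \<alpha> \<le> \<gamma>})"
    by simp
  then show ?thesis
    unfolding cauchy_prod_def sum_distrib_right
    by (rule has_sum_SigmaD) (auto intro!: has_sum_finiteI finite_mindex_le)
qed

lemma DA_uniqueI:
  assumes "c \<in> DA" "d \<in> DA" "\<And>z. z \<in> ball_d \<Longrightarrow> ev c z = ev d z"
  shows "c = d"
  using assms by (intro power_series_unique DA_ev_summable)

lemma cauchy_prod_summable: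
  assumes "c \<in> DA" "f \<in> DA" "z \<in> ball_d"
  shows "(\<lambda>\<gamma>. cauchy_prod c f \<gamma> * zmon z \<gamma>) summable_on UNIV"
  using cauchy_prod_has_sum[OF DA_ev_summable[OF assms(1,3)] DA_ev_summable[OF assms(2,3)]]
  by (rule has_sum_imp_summable)

lemma ev_cauchy_prod:
  assumes "c \<in> DA" "f \<in> DA" "z \<in> ball_d"
  shows "ev (cauchy_prod c f) z = ev c z * ev f z"
  using cauchy_prod_has_sum[OF DA_ev_summable[OF assms(1,3)] DA_ev_summable[OF assms(2,3)]]
  unfolding ev_def[of "cauchy_prod c f"] by (rule infsumI)

section \<open>Multipliers\<close>

lemma cauchy_prod_add_left: "cauchy_prod (\<lambda>\<alpha>. c \<alpha> + d \<alpha>) f = (\<lambda>\<gamma>. cauchy_prod c f \<gamma> + cauchy_prod d f \<gamma>)"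
  by (simp add: cauchy_prod_def sum.distrib algebra_simps fun_eq_iff)

lemma cauchy_prod_scale_left: "cauchy_prod (\<lambda>\<alpha>. k * c \<alpha>) f = (\<lambda>\<gamma>. k * cauchy_prod c f \<gamma>)"
  by (simp add: cauchy_prod_def sum_distrib_left algebra_simps fun_eq_iff)

lemma cauchy_prod_add_right: "cauchy_prod c (\<lambda>\<alpha>. f \<alpha> + g \<alpha>) = (\<lambda>\<gamma>. cauchy_prod c f \<gamma> + cauchy_prod c g \<gamma>)"
  by (simp add: cauchy_prod_def sum.distrib algebra_simps fun_eq_iff)

lemma cauchy_prod_scale_right: "cauchy_prod c (\<lambda>\<alpha>. k * f \<alpha>) = (\<lambda>\<gamma>. k * cauchy_prod c f \<gamma>)"
  by (simp add: cauchy_prod_def sum_distrib_left algebra_simps fun_eq_iff)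

definition const_one :: "'n::finite mindex \<Rightarrow> complex" where
  "const_one \<alpha> = (if \<alpha> = (\<lambda>_. 0) then 1 else 0)"

lemma DA_norm_le_const_one: "DA_norm_le (const_one :: 'n::finite mindex \<Rightarrow> complex) 1"
  unfolding DA_norm_le_def l2_norm_le_def
proof (intro allI impI)
  fix F :: "'n mindex set" assume F: "finite F"
  have "(\<Sum>\<alpha>\<in>F. (cmod (const_one \<alpha> * of_real (sqrt (daw \<alpha>))))\<^sup>2) = (\<Sum>\<alpha>\<in>F. if \<alpha> = (\<lambda>_. 0) then 1 else 0)"
    by (rule sum.cong) (auto simp: const_one_def daw_def)
  also have "\<dots> \<le> 1" using F by simp
  finally show "L2_set (\<lambda>\<alpha>. cmod (const_one \<alpha> * of_real (sqrt (daw \<alpha>)))) F \<le> 1"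
    by (simp add: L2_set_def)
qed

lemma cauchy_prod_const_one_right: "cauchy_prod c const_one = c"
proof
  fix \<gamma> :: "'a mindex"
  have "cauchy_prod c const_one \<gamma> = (\<Sum>\<alpha> | \<alpha> \<le> \<gamma>. if \<alpha> = \<gamma> then c \<alpha> else 0)"
    unfolding cauchy_prod_def
    by (rule sum.cong) (auto simp: const_one_def fun_eq_iff le_fun_def le_antisym)
  also have "\<dots> = c \<gamma>" using finite_mindex_le[of \<gamma>] by simp
  finally show "cauchy_prod c const_one \<gamma> = c \<gamma>" .
qed

lemma ev_const_one: "ev const_one z = 1"
proof -
  have "((\<lambda>\<alpha>. const_one \<alpha> * zmon z \<alpha>) has_sum 1) UNIV"
    by (rule has_sum_finite_neutralI[of "{\<lambda>_. 0}"]) (auto simp: const_one_def zmon_def)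
  then show ?thesis unfolding ev_def by (rule infsumI)
qed

lemma ev_add:
  assumes "c \<in> DA" "d \<in> DA" "z \<in> ball_d"
  shows "ev (\<lambda>\<alpha>. c \<alpha> + d \<alpha>) z = ev c z + ev d z"
  unfolding ev_def using infsum_add[OF assms(1,2)[THEN DA_ev_summable, OF assms(3)]]
  by (simp add: algebra_simps)

lemma ev_scale: "ev (\<lambda>\<alpha>. k * c \<alpha>) z = k * ev c z"
  unfolding ev_def by (simp add: mult.assoc infsum_cmult_right')

lemma DA_add: "c \<in> DA \<Longrightarrow> d \<in> DA \<Longrightarrow> (\<lambda>\<alpha>. c \<alpha> + d \<alpha>) \<in> DA"
  using DA_norm_le_add unfolding DA_iff_DA_norm_le by blast

lemma DA_scale: "c \<in> DA \<Longrightarrow> (\<lambda>\<alpha>. k * c \<alpha>) \<in> DA"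
  using DA_norm_le_scale unfolding DA_iff_DA_norm_le by blast

definition mult_coeff :: "('n::finite mindex \<Rightarrow> complex) \<Rightarrow> bool" where
  "mult_coeff c \<longleftrightarrow> c \<in> DA \<and> (\<forall>f\<in>DA. cauchy_prod c f \<in> DA)"

definition ev_ball :: "('n::finite mindex \<Rightarrow> complex) \<Rightarrow> complex ^ 'n \<Rightarrow> complex" where
  "ev_ball c z = (if z \<in> ball_d then ev c z else 0)"

lemma multop_ev_ball:
  assumes "mult_coeff c" "f \<in> DA"
  shows "multop (ev_ball c) f = cauchy_prod c f"
  unfolding multop_def
proof (rule the_equality)
  have c: "c \<in> DA" "cauchy_prod c f \<in> DA" using assms by (auto simp: mult_coeff_def)
  show *: "cauchy_prod c f \<in> DA \<and> (\<forall>z\<in>ball_d. ev (cauchy_prod c f) z = ev_ball c z * ev f z)"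
    using c assms(2) by (simp add: ev_ball_def ev_cauchy_prod)
  show "e = cauchy_prod c f" if "e \<in> DA \<and> (\<forall>z\<in>ball_d. ev e z = ev_ball c z * ev f z)" for e
    using that * by (intro DA_uniqueI) auto
qed

lemma ev_ball_multiplier:
  assumes "mult_coeff c"
  shows "ev_ball c \<in> multipliers"
  unfolding multipliers_def
proof (intro CollectI conjI allI impI ballI)
  fix f :: "'a mindex \<Rightarrow> complex" assume "f \<in> DA"
  then show "\<exists>e\<in>DA. \<forall>z\<in>ball_d. ev e z = ev_ball c z * ev f z"
    using assms by (intro bexI[of _ "cauchy_prod c f"]) (auto simp: mult_coeff_def ev_ball_def ev_cauchy_prod)
qed (simp add: ev_ball_def)

text \<open>Applying the multiplier to the constant function 1 yields the coefficients
  \<open>c\<close>; uniqueness of power series then identifies every product with a Cauchy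
  product.\<close>

lemma multiplier_ev_ball:
  assumes "\<phi> \<in> multipliers"
  obtains c where "mult_coeff c" "\<phi> = ev_ball c"
proof -
  have m: "\<exists>e\<in>DA. \<forall>z\<in>ball_d. ev e z = \<phi> z * ev f z" if "f \<in> DA" for f
    using assms that by (auto simp: multipliers_def)
  obtain c where c: "c \<in> DA" "\<And>z. z \<in> ball_d \<Longrightarrow> ev c z = \<phi> z"
    using m[OF DA_norm_le_imp_DA[OF DA_norm_le_const_one]] by (auto simp: ev_const_one)
  have "cauchy_prod c f \<in> DA" if f: "f \<in> DA" for f
  proof -
    obtain e where e: "e \<in> DA" "\<And>z. z \<in> ball_d \<Longrightarrow> ev e z = \<phi> z * ev f z"
      using m[OF f] by auto
    have "e = cauchy_prod c f"
      by (rule power_series_unique) (use e c f in \<open>auto intro: DA_ev_summable cauchy_prod_summable simp: ev_cauchy_prod\<close>)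
    with e(1) show ?thesis by simp
  qed
  then have "mult_coeff c" using c(1) by (simp add: mult_coeff_def)
  moreover have "\<phi> = ev_ball c"
    using assms c(2) by (auto simp: fun_eq_iff ev_ball_def multipliers_def)
  ultimately show ?thesis using that by blast
qed

lemma multipliers_add: "\<phi> \<in> multipliers \<Longrightarrow> \<psi> \<in> multipliers \<Longrightarrow> (\<lambda>z. \<phi> z + \<psi> z) \<in> multipliers"
proof -
  assume "\<phi> \<in> multipliers" "\<psi> \<in> multipliers"
  then obtain c d where cd: "mult_coeff c" "\<phi> = ev_ball c" "mult_coeff d" "\<psi> = ev_ball d"
    by (metis multiplier_ev_ball)
  then have "(\<lambda>z. \<phi> z + \<psi> z) = ev_ball (\<lambda>\<alpha>. c \<alpha> + d \<alpha>)"
    by (auto simp: ev_ball_def ev_add mult_coeff_def)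
  moreover have "mult_coeff (\<lambda>\<alpha>. c \<alpha> + d \<alpha>)"
    using cd by (auto simp: mult_coeff_def cauchy_prod_add_left DA_add)
  ultimately show ?thesis using ev_ball_multiplier by metis
qed

lemma multipliers_scale: "\<phi> \<in> multipliers \<Longrightarrow> (\<lambda>z. k * \<phi> z) \<in> multipliers"
proof -
  assume "\<phi> \<in> multipliers"
  then obtain c where c: "mult_coeff c" "\<phi> = ev_ball c"
    by (metis multiplier_ev_ball)
  then have "(\<lambda>z. k * \<phi> z) = ev_ball (\<lambda>\<alpha>. k * c \<alpha>)"
    by (auto simp: ev_ball_def ev_scale)
  moreover have "mult_coeff (\<lambda>\<alpha>. k * c \<alpha>)"
    using c by (auto simp: mult_coeff_def cauchy_prod_scale_left DA_scale)
  ultimately show ?thesis using ev_ball_multiplier by metis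
qed

lemma multipliers_mult:
  assumes "\<phi> \<in> multipliers" "\<psi> \<in> multipliers"
  shows "(\<lambda>z. \<phi> z * \<psi> z) \<in> multipliers"
  unfolding multipliers_def
proof (intro CollectI conjI allI impI ballI)
  fix c :: "'a mindex \<Rightarrow> complex" assume "c \<in> DA"
  then obtain d where d: "d \<in> DA" "\<forall>z\<in>ball_d. ev d z = \<psi> z * ev c z"
    using assms(2) by (auto simp: multipliers_def)
  then obtain e where e: "e \<in> DA" "\<forall>z\<in>ball_d. ev e z = \<phi> z * ev d z"
    using assms(1) by (auto simp: multipliers_def)
  show "\<exists>e\<in>DA. \<forall>z\<in>ball_d. ev e z = \<phi> z * \<psi> z * ev c z"
    using d e by (intro bexI[of _ e]) auto
qed (use assms in \<open>auto simp: multipliers_def\<close>)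

section \<open>Multiplier norms and the uniform boundedness principle\<close>

definition mult_norm_le :: "('n::finite mindex \<Rightarrow> complex) \<Rightarrow> real \<Rightarrow> bool" where
  "mult_norm_le c K \<longleftrightarrow> 0 \<le> K \<and> (\<forall>h B. DA_norm_le h B \<longrightarrow> DA_norm_le (cauchy_prod c h) (K * B))"

lemma mult_norm_le_DA_norm_le: "mult_norm_le c K \<Longrightarrow> DA_norm_le c K"
  using DA_norm_le_const_one unfolding mult_norm_le_def by (metis cauchy_prod_const_one_right mult.right_neutral)

lemma mult_norm_le_mult_coeff: "mult_norm_le c K \<Longrightarrow> mult_coeff c"
  unfolding mult_coeff_def using mult_norm_le_DA_norm_le DA_iff_DA_norm_le by (metis mult_norm_le_def)

text \<open>A coefficient of a Cauchy product involves only finitely many coefficients of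
  \<open>c m\<close>, so it passes to the limit; the norm bound then survives as in Fatou's
  lemma.\<close>

lemma mult_norm_le_limit:
  assumes c: "\<And>m. mult_norm_le (c m) K" and lim: "\<And>\<alpha>. (\<lambda>m. c m \<alpha>) \<longlonglongrightarrow> d \<alpha>"
  shows "mult_norm_le d K" "\<And>h \<gamma>. (\<lambda>m. cauchy_prod (c m) h \<gamma>) \<longlonglongrightarrow> cauchy_prod d h \<gamma>"
proof -
  show cauchy_prod: "(\<lambda>m. cauchy_prod (c m) h \<gamma>) \<longlonglongrightarrow> cauchy_prod d h \<gamma>" for h \<gamma>
    unfolding cauchy_prod_def by (intro tendsto_intros lim)
  show "mult_norm_le d K"
    unfolding mult_norm_le_def
  proof (intro conjI allI impI)
    show "0 \<le> K" using c by (auto simp: mult_norm_le_def)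
    fix h :: "'a mindex \<Rightarrow> complex" and B assume "DA_norm_le h B"
    then show "DA_norm_le (cauchy_prod d h) (K * B)"
      by (intro DA_norm_le_limit[of "\<lambda>m. cauchy_prod (c m) h", OF _ cauchy_prod]) (use c in \<open>auto simp: mult_norm_le_def\<close>)
  qed
qed

text \<open>These are the seminorms for the uniform boundedness principle: each sees finitely many
  coefficients of a product, and their supremum over finite \<open>F\<close> is the norm.\<close>

definition trunc_norm :: "('n::finite mindex \<Rightarrow> complex) \<Rightarrow> 'n mindex set \<Rightarrow> real" where
  "trunc_norm d F = L2_set (\<lambda>\<gamma>. cmod (d \<gamma> * of_real (sqrt (daw \<gamma>)))) F"

lemma DA_norm_le_iff_trunc_norm: "DA_norm_le d B \<longleftrightarrow> (\<forall>F. finite F \<longrightarrow> trunc_norm d F \<le> B)"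
  by (simp add: DA_norm_le_def l2_norm_le_def trunc_norm_def)

lemma trunc_norm_add: "trunc_norm (\<lambda>\<gamma>. c \<gamma> + d \<gamma>) F \<le> trunc_norm c F + trunc_norm d F"
proof -
  have "trunc_norm (\<lambda>\<gamma>. c \<gamma> + d \<gamma>) F \<le> L2_set (\<lambda>\<gamma>. cmod (c \<gamma> * of_real (sqrt (daw \<gamma>))) + cmod (d \<gamma> * of_real (sqrt (daw \<gamma>)))) F"
    unfolding trunc_norm_def by (rule L2_set_mono) (auto intro: norm_triangle_ineq simp: distrib_right)
  also have "\<dots> \<le> trunc_norm c F + trunc_norm d F"
    unfolding trunc_norm_def by (rule L2_set_triangle_ineq)
  finally show ?thesis .
qed

lemma trunc_norm_scale: "trunc_norm (\<lambda>\<gamma>. k * c \<gamma>) F = cmod k * trunc_norm c F"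
  unfolding trunc_norm_def by (simp add: norm_mult mult.assoc L2_set_right_distrib)

text \<open>Only finitely many coefficients of \<open>f\<close> enter, namely those with an index
  below some element of \<open>F\<close>, and \<open>B\<close> controls each of them.\<close>

lemma trunc_norm_cauchy_prod_bounded:
  assumes "finite F"
  shows "\<exists>C. \<forall>f B. DA_norm_le f B \<longrightarrow> trunc_norm (cauchy_prod c f) F \<le> C * B"
proof (intro exI allI impI)
  fix f :: "'a mindex \<Rightarrow> complex" and B assume f: "DA_norm_le f B"
  let ?C = "\<Sum>\<gamma>\<in>F. (\<Sum>\<alpha> | \<alpha> \<le> \<gamma>. cmod (c \<alpha>) / sqrt (daw (\<lambda>i. \<gamma> i - \<alpha> i))) * sqrt (daw \<gamma>)"
  have "cmod (cauchy_prod c f \<gamma>) \<le> (\<Sum>\<alpha> | \<alpha> \<le> \<gamma>. cmod (c \<alpha>) / sqrt (daw (\<lambda>i. \<gamma> i - \<alpha> i))) * B" for \<gamma>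
    unfolding cauchy_prod_def sum_distrib_right
  proof (rule order_trans[OF norm_sum sum_mono])
    fix \<alpha>
    show "cmod (c \<alpha> * f (\<lambda>i. \<gamma> i - \<alpha> i)) \<le> cmod (c \<alpha>) / sqrt (daw (\<lambda>i. \<gamma> i - \<alpha> i)) * B"
      using mult_left_mono[OF DA_norm_le_coeff[OF f, of "\<lambda>i. \<gamma> i - \<alpha> i"], of "cmod (c \<alpha>)"]
      by (simp add: norm_mult)
  qed
  then have le: "cmod (cauchy_prod c f \<gamma> * of_real (sqrt (daw \<gamma>))) \<le> (\<Sum>\<alpha> | \<alpha> \<le> \<gamma>. cmod (c \<alpha>) / sqrt (daw (\<lambda>i. \<gamma> i - \<alpha> i))) * sqrt (daw \<gamma>) * B" for \<gamma>
    using mult_right_mono[of "cmod (cauchy_prod c f \<gamma>)" _ "sqrt (daw \<gamma>)"] daw_pos[of \<gamma>]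
    by (simp add: norm_mult mult.assoc mult.commute mult.left_commute)
  have "trunc_norm (cauchy_prod c f) F \<le> (\<Sum>\<gamma>\<in>F. cmod (cauchy_prod c f \<gamma> * of_real (sqrt (daw \<gamma>))))"
    unfolding trunc_norm_def by (rule L2_set_le_sum) auto
  also have "\<dots> \<le> ?C * B"
    unfolding sum_distrib_right using le by (intro sum_mono) (simp add: sum_distrib_right)
  finally show "trunc_norm (cauchy_prod c f) F \<le> ?C * B" .
qed

text \<open>Since \<open>2 y = (x + y) - (x - y)\<close>, one of \<open>s = 1\<close> and
  \<open>s = -1\<close> works.\<close>

lemma one_of_sum_diff_large:
  fixes x y :: "'n::finite mindex \<Rightarrow> complex"
  shows "\<exists>s. cmod s = 1 \<and> trunc_norm (cauchy_prod c y) F \<le> trunc_norm (cauchy_prod c (\<lambda>\<alpha>. x \<alpha> + s * y \<alpha>)) F"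
proof (rule ccontr)
  assume "\<not> ?thesis"
  then have lt: "trunc_norm (cauchy_prod c (\<lambda>\<alpha>. x \<alpha> + s * y \<alpha>)) F < trunc_norm (cauchy_prod c y) F" if "cmod s = 1" for s
    using that by force
  have "(\<lambda>\<alpha>. (x \<alpha> + 1 * y \<alpha>) + (-1) * (x \<alpha> + (-1) * y \<alpha>)) = (\<lambda>\<alpha>. 2 * y \<alpha>)"
    by (simp add: fun_eq_iff)
  then have "2 * trunc_norm (cauchy_prod c y) F = trunc_norm (cauchy_prod c (\<lambda>\<alpha>. (x \<alpha> + 1 * y \<alpha>) + (-1) * (x \<alpha> + (-1) * y \<alpha>))) F"
    by (simp only: cauchy_prod_scale_right trunc_norm_scale) simp
  also have "\<dots> \<le> trunc_norm (cauchy_prod c (\<lambda>\<alpha>. x \<alpha> + 1 * y \<alpha>)) F + cmod (-1) * trunc_norm (cauchy_prod c (\<lambda>\<alpha>. x \<alpha> + (-1) * y \<alpha>)) F"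
    unfolding cauchy_prod_add_right[of c "\<lambda>\<alpha>. x \<alpha> + 1 * y \<alpha>"] cauchy_prod_scale_right[of c "-1" "\<lambda>\<alpha>. x \<alpha> + (-1) * y \<alpha>"]
      trunc_norm_scale[symmetric] by (rule trunc_norm_add)
  also have "\<dots> < 2 * trunc_norm (cauchy_prod c y) F"
    using lt[of 1] lt[of "-1"] by simp
  finally show False by simp
qed

text \<open>Sokal's proof of the uniform boundedness principle: perturb by \<open>3\<^sup>-\<^sup>n f\<^sub>n\<close>, where \<open>f\<^sub>n\<close>
  almost attains the norm of the \<open>n\<close>-th truncation of multiplication by \<open>c\<close>.\<close>

lemma multiplication_bounded:
  fixes c :: "'n::finite mindex \<Rightarrow> complex"
  assumes c: "mult_coeff c"
  shows "\<exists>K. mult_norm_le c K"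
proof (rule ccontr)
  assume neg: "\<nexists>K. mult_norm_le c K"
  define p where "p F f = trunc_norm (cauchy_prod c f) F" for F f
  have p_add: "p F (\<lambda>\<alpha>. f \<alpha> + g \<alpha>) \<le> p F f + p F g" for F f g
    unfolding p_def cauchy_prod_add_right by (rule trunc_norm_add)
  have p_scale: "p F (\<lambda>\<alpha>. k * f \<alpha>) = cmod k * p F f" for F f k
    unfolding p_def cauchy_prod_scale_right by (rule trunc_norm_scale)
  have p_norm: "p F f \<le> N * B" if "finite F" "\<And>g. DA_norm_le g 1 \<Longrightarrow> p F g \<le> N" "DA_norm_le f B" for F f N B
  proof (cases "B = 0")
    case True
    then show ?thesis using trunc_norm_cauchy_prod_bounded[OF that(1), of c] that(3) unfolding p_def by fastforce
  next
    case False
    then have B: "B > 0" using DA_norm_le_nonneg[OF that(3)] by simp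
    have "DA_norm_le (\<lambda>\<alpha>. of_real (1 / B) * f \<alpha>) 1"
      using DA_norm_le_scale[OF that(3), of "of_real (1 / B)"] B by (simp add: norm_divide)
    from that(2)[OF this] show ?thesis
      unfolding p_scale using B by (simp add: norm_divide field_simps)
  qed
  \<comment> \<open>\<open>N\<close> is the supremum of the seminorm over the unit ball; it need not
    be attained, and \<open>f\<close> reaches three quarters of it. It exceeds \<open>4 ^ n\<close>
    because \<open>4 ^ n\<close> does not bound multiplication by \<open>c\<close>.\<close>
  have ex: "\<exists>F N f. finite F \<and> (\<forall>g. DA_norm_le g 1 \<longrightarrow> p F g \<le> N) \<and> DA_norm_le f 1 \<and> 3 / 4 * N \<le> p F f \<and> 4 ^ n \<le> N" for n :: nat
  proof -
    obtain f B where f: "DA_norm_le f B" "\<not> DA_norm_le (cauchy_prod c f) (4 ^ n * B)"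
      using neg unfolding mult_norm_le_def by (metis zero_le_numeral zero_le_power)
    then obtain F where F: "finite F" "4 ^ n * B < p F f"
      unfolding DA_norm_le_iff_trunc_norm p_def by (auto simp: not_le)
    obtain C where C: "\<And>g B. DA_norm_le g B \<Longrightarrow> p F g \<le> C * B"
      using trunc_norm_cauchy_prod_bounded[OF F(1), of c] unfolding p_def by blast
    define N where "N = (SUP g\<in>{g. DA_norm_le g 1}. p F g)"
    have bdd: "bdd_above (p F ` {g. DA_norm_le g 1})"
      using C[of _ 1] by (intro bdd_aboveI2) auto
    have ne: "{g :: 'n mindex \<Rightarrow> complex. DA_norm_le g 1} \<noteq> {}" using DA_norm_le_const_one by blast
    have up: "\<forall>g. DA_norm_le g 1 \<longrightarrow> p F g \<le> N"
      unfolding N_def using bdd by (auto intro: cSUP_upper)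
    have "4 ^ n * B < N * B" using p_norm[OF F(1) _ f(1)] up F(2) by (meson less_le_trans)
    then have N: "4 ^ n < N" using DA_norm_le_nonneg[OF f(1)]
      by (meson mult_right_mono not_le)
    have N0: "0 < N" using N by (smt (verit) zero_less_power)
    then have "3 / 4 * N < N" by simp
    then obtain g where "DA_norm_le g 1" "3 / 4 * N < p F g"
      unfolding N_def less_cSUP_iff[OF ne bdd] by auto
    with F(1) up N show ?thesis by (meson less_imp_le)
  qed
  then obtain F N f where F: "\<And>n. finite (F n)" and N: "\<And>n g. DA_norm_le g 1 \<Longrightarrow> p (F n) g \<le> N n"
    and f: "\<And>n. DA_norm_le (f n) 1" and fN: "\<And>n. 3 / 4 * N n \<le> p (F n) (f n)" and N4: "\<And>n. 4 ^ n \<le> N n"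
    by metis
  define r where "r n = (1 / 3 :: real) ^ n" for n
  have r0: "0 < r n" for n by (simp add: r_def)
  \<comment> \<open>Step \<open>n\<close> moves by \<open>r n\<close> in the direction
    \<open>f n\<close>, up to a sign that keeps the \<open>n\<close>-th seminorm of the result at
    least as large as that of the increment. The clause for \<open>n = 0\<close> makes the sequence
    start at zero.\<close>
  have "\<exists>x. \<forall>n. (n = 0 \<longrightarrow> x n = (\<lambda>_. 0)) \<and> (\<exists>s. cmod s = 1 \<and> x (Suc n) = (\<lambda>\<alpha>. x n \<alpha> + s * (of_real (r n) * f n \<alpha>))
      \<and> r n * p (F n) (f n) \<le> p (F n) (x (Suc n)))"
  proof (rule dependent_nat_choice)
    show "\<exists>x :: 'n mindex \<Rightarrow> complex. (0::nat) = 0 \<longrightarrow> x = (\<lambda>_. 0)" by blast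
    fix x :: "'n mindex \<Rightarrow> complex" and n :: nat
    obtain s where s: "cmod s = 1" "p (F n) (\<lambda>\<alpha>. of_real (r n) * f n \<alpha>) \<le> p (F n) (\<lambda>\<alpha>. x \<alpha> + s * (of_real (r n) * f n \<alpha>))"
      unfolding p_def using one_of_sum_diff_large by blast
    then show "\<exists>y. (Suc n = 0 \<longrightarrow> y = (\<lambda>_. 0)) \<and> (\<exists>s. cmod s = 1 \<and> y = (\<lambda>\<alpha>. x \<alpha> + s * (of_real (r n) * f n \<alpha>))
      \<and> r n * p (F n) (f n) \<le> p (F n) y)"
      using r0[of n] unfolding p_scale
      by (intro exI[of _ "\<lambda>\<alpha>. x \<alpha> + s * (of_real (r n) * f n \<alpha>)"] conjI exI[of _ s]) simp_all
  qed
  then obtain x where x: "\<And>n. (n = 0 \<longrightarrow> x n = (\<lambda>_. 0)) \<and> (\<exists>s. cmod s = 1 \<and> x (Suc n) = (\<lambda>\<alpha>. x n \<alpha> + s * (of_real (r n) * f n \<alpha>))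
      \<and> r n * p (F n) (f n) \<le> p (F n) (x (Suc n)))"
    by blast
  then have x0: "x 0 = (\<lambda>_. 0)" by blast
  from x have "\<forall>n. \<exists>s. cmod s = 1 \<and> x (Suc n) = (\<lambda>\<alpha>. x n \<alpha> + s * (of_real (r n) * f n \<alpha>))
      \<and> r n * p (F n) (f n) \<le> p (F n) (x (Suc n))"
    by blast
  from choice[OF this] obtain s where s: "\<And>n. cmod (s n) = 1"
    and xS: "\<And>n. x (Suc n) = (\<lambda>\<alpha>. x n \<alpha> + s n * (of_real (r n) * f n \<alpha>))"
    and xp: "\<And>n. r n * p (F n) (f n) \<le> p (F n) (x (Suc n))"
    by blast
  \<comment> \<open>The bound is the geometric sum of the step sizes \<open>r i\<close> for
    \<open>n \<le> i < m + n\<close>.\<close>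
  have diff: "DA_norm_le (\<lambda>\<alpha>. x (m + n) \<alpha> + (-1) * x n \<alpha>) (3 / 2 * (r n - r (m + n)))" for m n
  proof (induction m)
    case 0
    have "DA_norm_le (\<lambda>\<alpha>. 0 * const_one \<alpha>) (cmod 0 * 1)" by (rule DA_norm_le_scale[OF DA_norm_le_const_one])
    then show ?case by simp
  next
    case (Suc m)
    have "DA_norm_le (\<lambda>\<alpha>. s (m + n) * of_real (r (m + n)) * f (m + n) \<alpha>) (cmod (s (m + n) * of_real (r (m + n))) * 1)"
      by (rule DA_norm_le_scale[OF f])
    then have "DA_norm_le (\<lambda>\<alpha>. s (m + n) * of_real (r (m + n)) * f (m + n) \<alpha>) (r (m + n))"
      using r0[of "m + n"] by (simp add: norm_mult s)
    from DA_norm_le_add[OF Suc this]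
    show ?case by (simp add: xS algebra_simps r_def)
  qed
  have "\<exists>l. (\<lambda>n. x n \<alpha>) \<longlonglongrightarrow> l" for \<alpha>
  proof -
    have "summable (\<lambda>n. x (Suc n) \<alpha> - x n \<alpha>)"
    proof (rule summable_comparison_test')
      show "summable (\<lambda>n. r n * (1 / sqrt (daw \<alpha>)))"
        unfolding r_def by (intro summable_mult2 summable_geometric) simp
      show "norm (x (Suc n) \<alpha> - x n \<alpha>) \<le> r n * (1 / sqrt (daw \<alpha>))" for n
        using mult_left_mono[OF DA_norm_le_coeff[OF f[of n], of \<alpha>], of "r n"] r0[of n]
        by (simp add: xS norm_mult s)
    qed
    moreover have "(\<Sum>i<n. x (Suc i) \<alpha> - x i \<alpha>) = x n \<alpha>" for n
      using sum_lessThan_telescope[of "\<lambda>i. x i \<alpha>" n] by (simp add: x0)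
    ultimately show ?thesis
      using summable_LIMSEQ[of "\<lambda>n. x (Suc n) \<alpha> - x n \<alpha>"] by auto
  qed
  then obtain l where l: "\<And>\<alpha>. (\<lambda>n. x n \<alpha>) \<longlonglongrightarrow> l \<alpha>" by metis
  have tail: "DA_norm_le (\<lambda>\<alpha>. l \<alpha> + (-1) * x n \<alpha>) (3 / 2 * r n)" for n
  proof (rule DA_norm_le_limit)
    show "DA_norm_le (\<lambda>\<alpha>. x (m + n) \<alpha> + (-1) * x n \<alpha>) (3 / 2 * r n)" for m
      by (rule DA_norm_le_mono[OF diff]) (use r0[of "m + n"] in simp)
    show "(\<lambda>m. x (m + n) \<alpha> + (-1) * x n \<alpha>) \<longlonglongrightarrow> l \<alpha> + (-1) * x n \<alpha>" for \<alpha>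
      by (intro tendsto_intros LIMSEQ_ignore_initial_segment l)
  qed
  have "l \<in> DA" using tail[of 0] x0 DA_norm_le_imp_DA by force
  then obtain B where B: "DA_norm_le (cauchy_prod c l) B"
    using c DA_iff_DA_norm_le[of "cauchy_prod c l"] by (auto simp: mult_coeff_def)
  \<comment> \<open>Step \<open>n\<close> gains \<open>3 / 4 * N n * r n\<close>. All later steps
    together have size \<open>3 / 2 * r (Suc n) = r n / 2\<close> and cost at most
    \<open>N n * r n / 2\<close>. The remaining quarter of \<open>N n * r n\<close> is at least
    \<open>(4 / 3) ^ n / 4\<close>, which grows without bound.\<close>
  have "(4 / 3) ^ n / 4 \<le> B" for n
  proof -
    have "p (F n) (\<lambda>\<alpha>. l \<alpha> + (-1) * (l \<alpha> + (-1) * x (Suc n) \<alpha>)) \<le> p (F n) l + p (F n) (\<lambda>\<alpha>. (-1) * (l \<alpha> + (-1) * x (Suc n) \<alpha>))"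
      by (rule p_add)
    also have "(\<lambda>\<alpha>. l \<alpha> + (-1) * (l \<alpha> + (-1) * x (Suc n) \<alpha>)) = x (Suc n)"
      by (simp add: fun_eq_iff)
    also have "p (F n) (\<lambda>\<alpha>. (-1) * (l \<alpha> + (-1) * x (Suc n) \<alpha>)) = p (F n) (\<lambda>\<alpha>. l \<alpha> + (-1) * x (Suc n) \<alpha>)"
      unfolding p_scale[of _ "-1"] by simp
    also have "\<dots> \<le> N n * (3 / 2 * r (Suc n))"
      by (rule p_norm[OF F N tail])
    finally have "p (F n) (x (Suc n)) \<le> p (F n) l + N n * r n / 2"
      by (simp add: r_def)
    moreover have "r n * (3 / 4 * N n) \<le> r n * p (F n) (f n)"
      using fN r0[of n] by (intro mult_left_mono) auto
    ultimately have "N n * r n / 4 \<le> p (F n) l"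
      using xp[of n] by (simp add: algebra_simps)
    also have "p (F n) l \<le> B"
      using B F unfolding p_def DA_norm_le_iff_trunc_norm by blast
    finally have "N n * r n / 4 \<le> B" .
    moreover have "(4 / 3) ^ n \<le> N n * r n"
      using mult_right_mono[OF N4[of n], of "r n"] r0[of n] by (simp add: r_def power_divide)
    ultimately show ?thesis by simp
  qed
  moreover obtain n where "4 * B < (4 / 3) ^ n"
    using real_arch_pow[of "4 / 3" "4 * B"] by auto
  ultimately have "(4 / 3) ^ n / 4 \<le> B" "4 * B < (4 / 3) ^ n" by blast+
  then show False by linarith
qed

section \<open>Weak-* limits of bounded sequences of multipliers\<close>

lemma generate_topology_on_eventually:
  assumes "generate_topology_on S V" "x \<in> V"
    and "\<And>U. U \<in> S \<Longrightarrow> x \<in> U \<Longrightarrow> \<forall>\<^sub>F m in sequentially. y m \<in> U"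
  shows "\<forall>\<^sub>F m in sequentially. y m \<in> V"
  using assms(1,2)
proof (induction rule: generate_topology_on.induct)
  case (UN K)
  then obtain k where "k \<in> K" "x \<in> k" by blast
  with UN.IH[OF this] show ?case by (auto elim: eventually_mono)
qed (auto intro: assms(3) eventually_conj)

lemma sqrt_mult_le_add:
  fixes a b :: real
  assumes "0 \<le> a" "0 \<le> b"
  shows "sqrt a * sqrt b \<le> a + b"
  using arith_geo_mean_sqrt[OF assms] assms by (simp add: real_sqrt_mult)

lemma danorm2_nonneg: "0 \<le> danorm2 c"
  unfolding danorm2_def using less_imp_le[OF daw_pos] by (intro infsum_nonneg mult_nonneg_nonneg) auto

text \<open>Bounded coefficientwise convergence is weak-* convergence: each single pairing converges
  by weak convergence in the Drury-Arveson space, and Tannery's theorem sums the pairings.\<close>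

lemma weakstar_M_eventually:
  fixes c :: "nat \<Rightarrow> 'n::finite mindex \<Rightarrow> complex"
  assumes c: "\<And>m. mult_norm_le (c m) K" and lim: "\<And>\<alpha>. (\<lambda>m. c m \<alpha>) \<longlonglongrightarrow> d \<alpha>"
    and V: "openin weakstar_M V" "ev_ball d \<in> V"
  shows "\<forall>\<^sub>F m in sequentially. ev_ball (c m) \<in> V"
proof (rule generate_topology_on_eventually[OF _ V(2)])
  show "generate_topology_on {{\<phi>\<in>multipliers. (\<Sum>\<^sub>\<infinity>n. dainner (multop \<phi> (f n)) (g n)) \<in> U} | f g U.
        (\<forall>n. f n \<in> DA \<and> g n \<in> DA) \<and> summable (\<lambda>n. danorm2 (f n)) \<and>
        summable (\<lambda>n. danorm2 (g n)) \<and> open U} V"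
    using V(1) unfolding weakstar_M_def openin_topology_generated_by_iff .
  fix W :: "(complex ^ 'n \<Rightarrow> complex) set"
  assume "W \<in> {{\<phi>\<in>multipliers. (\<Sum>\<^sub>\<infinity>n. dainner (multop \<phi> (f n)) (g n)) \<in> U} | f g U.
        (\<forall>n. f n \<in> DA \<and> g n \<in> DA) \<and> summable (\<lambda>n. danorm2 (f n)) \<and>
        summable (\<lambda>n. danorm2 (g n)) \<and> open U}"
  then obtain f g U where W: "W = {\<phi>\<in>multipliers. (\<Sum>\<^sub>\<infinity>n. dainner (multop \<phi> (f n)) (g n)) \<in> U}"
    and f: "\<And>n. f n \<in> DA" "summable (\<lambda>n. danorm2 (f n))"
    and g: "\<And>n. g n \<in> DA" "summable (\<lambda>n. danorm2 (g n))" and U: "open U"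
    by auto
  assume dW: "ev_ball d \<in> W"
  have d: "mult_norm_le d K" by (rule mult_norm_le_limit[OF c lim])
  \<comment> \<open>Cauchy-Schwarz bounds a pairing by \<open>K\<close> times a product of norms,
    hence by \<open>K\<close> times the sum of their squares, which is summable.\<close>
  define M where "M n = K * (danorm2 (f n) + danorm2 (g n))" for n
  have M: "summable M" unfolding M_def by (intro summable_mult summable_add f g)
  have bound: "cmod (dainner (cauchy_prod e (f n)) (g n)) \<le> M n" if "mult_norm_le e K" for e n
  proof -
    have "DA_norm_le (cauchy_prod e (f n)) (K * sqrt (danorm2 (f n)))"
      using that DA_norm_le_danorm2[OF f(1)] by (auto simp: mult_norm_le_def)
    from dainner_le[OF this DA_norm_le_danorm2[OF g(1)]]
    have "cmod (dainner (cauchy_prod e (f n)) (g n)) \<le> K * (sqrt (danorm2 (f n)) * sqrt (danorm2 (g n)))"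
      by (simp add: mult.assoc)
    also have "\<dots> \<le> M n"
      unfolding M_def using that
      by (intro mult_left_mono sqrt_mult_le_add danorm2_nonneg) (auto simp: mult_norm_le_def)
    finally show ?thesis .
  qed
  have suminf: "(\<Sum>\<^sub>\<infinity>n. dainner (multop (ev_ball e) (f n)) (g n)) = (\<Sum>n. dainner (cauchy_prod e (f n)) (g n))" if "mult_norm_le e K" for e
  proof -
    have "summable (\<lambda>n. norm (dainner (cauchy_prod e (f n)) (g n)))"
      using bound[OF that] by (intro summable_comparison_test'[OF M]) simp
    from infsumI[OF norm_summable_imp_has_sum[OF this summable_sums[OF summable_norm_cancel[OF this]]]]
    show ?thesis
      by (simp only: multop_ev_ball[OF mult_norm_le_mult_coeff[OF that] f(1)])
  qed
  have "(\<lambda>m. \<Sum>n. dainner (cauchy_prod (c m) (f n)) (g n)) \<longlonglongrightarrow> (\<Sum>n. dainner (cauchy_prod d (f n)) (g n))"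
  proof (rule conjunct2[OF conjunct2[OF tannerys_theorem[OF _ _ M]]])
    show "(\<lambda>m. dainner (cauchy_prod (c m) (f n)) (g n)) \<longlonglongrightarrow> dainner (cauchy_prod d (f n)) (g n)" for n
    proof (rule dainner_limit)
      show "DA_norm_le (cauchy_prod (c m) (f n)) (K * sqrt (danorm2 (f n)))" for m
        using c DA_norm_le_danorm2[OF f(1)] by (auto simp: mult_norm_le_def)
    qed (intro mult_norm_le_limit[OF c lim] g)+
    show "\<forall>\<^sub>F (n, m) in sequentially \<times>\<^sub>F sequentially. norm (dainner (cauchy_prod (c m) (f n)) (g n)) \<le> M n"
      using bound[OF c] by (intro always_eventually) auto
  qed simp
  then have "\<forall>\<^sub>F m in sequentially. (\<Sum>n. dainner (cauchy_prod (c m) (f n)) (g n)) \<in> U"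
    by (rule topological_tendstoD) (use dW U suminf[OF d] in \<open>auto simp: W\<close>)
  then show "\<forall>\<^sub>F m in sequentially. ev_ball (c m) \<in> W"
    by eventually_elim (auto simp: W suminf[OF c] ev_ball_multiplier[OF mult_norm_le_mult_coeff[OF c]])
qed

text \<open>This takes the place of Banach-Alaoglu: the coefficients lie in a countable product of
  discs, which is compact and first countable, hence sequentially compact.\<close>

lemma mult_norm_le_subsequence:
  fixes c :: "nat \<Rightarrow> 'n::finite mindex \<Rightarrow> complex"
  assumes c: "\<And>m. mult_norm_le (c m) K"
  obtains r d where "strict_mono r" "\<And>\<alpha>. (\<lambda>m. c (r m) \<alpha>) \<longlonglongrightarrow> d \<alpha>"
proof -
  have "compactin (product_topology (\<lambda>_. euclidean) UNIV) (PiE UNIV (\<lambda>\<alpha> :: 'n mindex. cball (0::complex) (K / sqrt (daw \<alpha>))))"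
    unfolding compactin_PiE by (simp add: compact_eq_bounded_closed)
  then have "compact (PiE UNIV (\<lambda>\<alpha> :: 'n mindex. cball (0::complex) (K / sqrt (daw \<alpha>))))"
    by (simp add: euclidean_product_topology)
  moreover have "c m \<in> PiE UNIV (\<lambda>\<alpha>. cball 0 (K / sqrt (daw \<alpha>)))" for m
    using DA_norm_le_coeff[OF mult_norm_le_DA_norm_le[OF c]] by auto
  ultimately obtain d r where r: "strict_mono r" "(c \<circ> r) \<longlonglongrightarrow> d"
    by (meson compact_imp_seq_compact seq_compactE)
  have "(\<lambda>m. c (r m) \<alpha>) \<longlonglongrightarrow> d \<alpha>" for \<alpha>
  proof -
    have "continuous_on UNIV (\<lambda>h :: 'n mindex \<Rightarrow> complex. h \<alpha>)"
      by (rule continuous_on_product_coordinates)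
    from continuous_on_tendsto_compose[OF this r(2)] show ?thesis by (simp add: o_def)
  qed
  with r(1) show ?thesis using that by blast
qed

lemma mult_norm_le_add: "mult_norm_le c K \<Longrightarrow> mult_norm_le d L \<Longrightarrow> mult_norm_le (\<lambda>\<alpha>. c \<alpha> + d \<alpha>) (K + L)"
  unfolding mult_norm_le_def by (auto simp: cauchy_prod_add_left distrib_right intro: DA_norm_le_add)

lemma mult_norm_le_scale: "mult_norm_le c K \<Longrightarrow> mult_norm_le (\<lambda>\<alpha>. k * c \<alpha>) (cmod k * K)"
  unfolding mult_norm_le_def by (auto simp: cauchy_prod_scale_left mult.assoc intro: DA_norm_le_scale)

lemma cauchy_prod_assoc:
  assumes "mult_coeff c" "mult_coeff d" "h \<in> DA"
  shows "cauchy_prod (cauchy_prod c d) h = cauchy_prod c (cauchy_prod d h)"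
  using assms
  by (intro power_series_unique) (auto intro: cauchy_prod_summable DA_ev_summable simp: mult_coeff_def ev_cauchy_prod)

lemma mult_norm_le_cauchy_prod:
  assumes "mult_norm_le c K" "mult_norm_le d L"
  shows "mult_norm_le (cauchy_prod c d) (K * L)"
  using assms cauchy_prod_assoc[OF mult_norm_le_mult_coeff[OF assms(1)] mult_norm_le_mult_coeff[OF assms(2)]]
  unfolding mult_norm_le_def by (auto simp: DA_norm_le_imp_DA mult.assoc)

lemma mult_norm_le_mono: "mult_norm_le c K \<Longrightarrow> K \<le> L \<Longrightarrow> mult_norm_le c L"
  unfolding mult_norm_le_def by (auto intro: DA_norm_le_mono dest: DA_norm_le_nonneg intro!: mult_right_mono)

text \<open>Here \<open>R f K\<close> asks for an interpolant of multiplier norm at most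
  \<open>K\<close>. The uniform constant is what allows weak-* limits of interpolants of shrinking
  tails of \<Lambda>.\<close>

lemma interpolating_indicators_bounded:
  assumes \<Lambda>: "\<Lambda> \<subseteq> ball_d" "interpolating \<Lambda>"
  shows "\<exists>K. \<forall>A. \<exists>c. mult_norm_le c K \<and> (\<forall>z\<in>\<Lambda>. ev_ball c z = indicator A z)"
proof (rule indicators_uniformly_bounded[where L = \<Lambda> and R = "\<lambda>f K. \<exists>c. mult_norm_le c K \<and> (\<forall>z\<in>\<Lambda>. ev_ball c z = f z)"], goal_cases)
  case (1 f)
  then obtain \<phi> where \<phi>: "\<phi> \<in> multipliers" "\<forall>z\<in>\<Lambda>. \<phi> z = f z"
    using \<Lambda>(2) by (auto simp: interpolating_def)
  obtain c where "mult_coeff c" "\<phi> = ev_ball c" using multiplier_ev_ball[OF \<phi>(1)] .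
  then show ?case using \<phi>(2) multiplication_bounded by metis
next
  case (3 f K)
  then show ?case by (auto simp: mult_norm_le_def)
next
  case (4 f K K')
  then show ?case using mult_norm_le_mono by blast
next
  case (5 f g K M)
  then obtain c d where "mult_norm_le c K" "mult_norm_le d M" "\<forall>z\<in>\<Lambda>. ev_ball c z = f z" "\<forall>z\<in>\<Lambda>. ev_ball d z = g z" by blast
  then show ?case using \<Lambda>(1)
    by (intro exI[of _ "\<lambda>\<alpha>. c \<alpha> + d \<alpha>"]) (auto simp: mult_norm_le_add ev_ball_def ev_add DA_norm_le_imp_DA[OF mult_norm_le_DA_norm_le] subset_iff)
next
  case (6 f g K M)
  then obtain c d where "mult_norm_le c K" "mult_norm_le d M" "\<forall>z\<in>\<Lambda>. ev_ball c z = f z" "\<forall>z\<in>\<Lambda>. ev_ball d z = g z" by blast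
  then show ?case using \<Lambda>(1)
    by (intro exI[of _ "cauchy_prod c d"]) (auto simp: mult_norm_le_cauchy_prod ev_ball_def ev_cauchy_prod DA_norm_le_imp_DA[OF mult_norm_le_DA_norm_le] subset_iff)
next
  case (7 f K k)
  then obtain c where "mult_norm_le c K" "\<forall>z\<in>\<Lambda>. ev_ball c z = f z" by blast
  then show ?case
    by (intro exI[of _ "\<lambda>\<alpha>. k * c \<alpha>"]) (auto simp: mult_norm_le_scale ev_ball_def ev_scale)
qed auto

section \<open>The functional calculus has no part at infinity of \<Lambda>\<close>

lemma ac_calculusD:
  assumes "ac_calculus J T \<Phi>"
  shows ac_calculus_BH: "\<phi> \<in> multipliers \<Longrightarrow> \<Phi> \<phi> \<in> BH J"
    and ac_calculus_add: "\<phi> \<in> multipliers \<Longrightarrow> \<psi> \<in> multipliers \<Longrightarrow> \<Phi> (\<lambda>z. \<phi> z + \<psi> z) = (\<lambda>x. \<Phi> \<phi> x + \<Phi> \<psi> x)"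
    and ac_calculus_scale: "\<phi> \<in> multipliers \<Longrightarrow> \<Phi> (\<lambda>z. k * \<phi> z) = (\<lambda>x. cscale J k (\<Phi> \<phi> x))"
    and ac_calculus_mult: "\<phi> \<in> multipliers \<Longrightarrow> \<psi> \<in> multipliers \<Longrightarrow> \<Phi> (\<lambda>z. \<phi> z * \<psi> z) = \<Phi> \<phi> \<circ> \<Phi> \<psi>"
    and ac_calculus_one: "\<Phi> (\<lambda>z. if z \<in> ball_d then 1 else 0) = id"
    and ac_calculus_poly: "p \<in> polys \<Longrightarrow> \<Phi> (polyfun p) = polycalc J T p"
    and ac_calculus_continuous: "continuous_map weakstar_M (weakstar_B J) \<Phi>"
proof -
  note a = assms[unfolded ac_calculus_def]
  show "\<phi> \<in> multipliers \<Longrightarrow> \<Phi> \<phi> \<in> BH J"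
    using conjunct1[OF a] by (rule bspec)
  note a = conjunct2[OF a]
  show "\<phi> \<in> multipliers \<Longrightarrow> \<psi> \<in> multipliers \<Longrightarrow> \<Phi> (\<lambda>z. \<phi> z + \<psi> z) = (\<lambda>x. \<Phi> \<phi> x + \<Phi> \<psi> x)"
    by (rule bspec[OF bspec[OF conjunct1[OF a]]])
  note a = conjunct2[OF a]
  show "\<phi> \<in> multipliers \<Longrightarrow> \<Phi> (\<lambda>z. k * \<phi> z) = (\<lambda>x. cscale J k (\<Phi> \<phi> x))"
    by (rule spec[OF bspec[OF conjunct1[OF a]]])
  note a = conjunct2[OF a]
  show "\<phi> \<in> multipliers \<Longrightarrow> \<psi> \<in> multipliers \<Longrightarrow> \<Phi> (\<lambda>z. \<phi> z * \<psi> z) = \<Phi> \<phi> \<circ> \<Phi> \<psi>"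
    by (rule bspec[OF bspec[OF conjunct1[OF a]]])
  note a = conjunct2[OF a]
  show "\<Phi> (\<lambda>z. if z \<in> ball_d then 1 else 0) = id" by (rule conjunct1[OF a])
  note a = conjunct2[OF a]
  show "p \<in> polys \<Longrightarrow> \<Phi> (polyfun p) = polycalc J T p" by (rule bspec[OF conjunct1[OF a]])
  show "continuous_map weakstar_M (weakstar_B J) \<Phi>" by (rule conjunct2[OF a])
qed

text \<open>An interpolant of the indicator of a cofinite set fixes \<open>x\<close>, since 1 minus
  it has finite support on \<Lambda>. A weak-* limit of such interpolants vanishes on \<Lambda> and
  acts as zero. Pairing with \<open>x\<close> is weak-* continuous and so forces <x, x> = 0.\<close>

lemma finitely_supported_multipliers_separate:
  fixes \<Lambda> :: "(complex ^ 'n::finite) set"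
  assumes \<Lambda>: "countable \<Lambda>" "\<Lambda> \<subseteq> ball_d" "interpolating \<Lambda>"
    and \<Phi>: "ac_calculus J T \<Phi>" and ann: "v0 \<Lambda> \<subseteq> Ann \<Phi>"
    and x: "\<And>\<phi>. \<phi> \<in> multipliers \<Longrightarrow> finite {z\<in>\<Lambda>. \<phi> z \<noteq> 0} \<Longrightarrow> \<Phi> \<phi> x = 0"
  shows "x = 0"
proof (rule ccontr)
  assume x0: "x \<noteq> 0"
  note \<Phi>BH = ac_calculus_BH[OF \<Phi>] and \<Phi>add = ac_calculus_add[OF \<Phi>] and \<Phi>1 = ac_calculus_one[OF \<Phi>]
    and cont = ac_calculus_continuous[OF \<Phi>] and \<Phi>sc = ac_calculus_scale[OF \<Phi>]
  have one: "(\<lambda>z. if z \<in> ball_d then 1 else 0) = ev_ball const_one"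
    by (auto simp: ev_ball_def ev_const_one)
  have one_m: "ev_ball (const_one :: 'n mindex \<Rightarrow> complex) \<in> multipliers"
    by (auto simp: multipliers_def ev_ball_def ev_const_one)
  obtain K where K: "\<forall>A. \<exists>c. mult_norm_le c K \<and> (\<forall>z\<in>\<Lambda>. ev_ball c z = indicator A z)"
    using interpolating_indicators_bounded[OF \<Lambda>(2,3)] by (rule exE)
  \<comment> \<open>Tails of an enumeration of \<Lambda>: each has finite complement in \<Lambda>,
    and every point eventually leaves them.\<close>
  define A where "A m = {z\<in>\<Lambda>. m \<le> to_nat_on \<Lambda> z}" for m
  have "\<forall>m. \<exists>c. mult_norm_le c K \<and> (\<forall>z\<in>\<Lambda>. ev_ball c z = indicator (A m) z)"
    using K by (intro allI) (rule spec)
  then obtain c where "\<forall>m. mult_norm_le (c m) K \<and> (\<forall>z\<in>\<Lambda>. ev_ball (c m) z = indicator (A m) z)"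
    by (rule exE[OF choice])
  then have c: "\<And>m. mult_norm_le (c m) K" "\<And>m z. z \<in> \<Lambda> \<Longrightarrow> ev_ball (c m) z = indicator (A m) z"
    by simp_all
  obtain r d where r: "strict_mono r" and lim: "\<And>\<alpha>. (\<lambda>m. c (r m) \<alpha>) \<longlonglongrightarrow> d \<alpha>"
    using mult_norm_le_subsequence[of c K, OF c(1)] by blast
  have d: "mult_norm_le d K" by (rule mult_norm_le_limit(1)[of "\<lambda>m. c (r m)", OF c(1) lim])
  have dm: "ev_ball d \<in> multipliers" by (rule ev_ball_multiplier[OF mult_norm_le_mult_coeff[OF d]])
  have cm: "ev_ball (c m) \<in> multipliers" for m by (rule ev_ball_multiplier[OF mult_norm_le_mult_coeff[OF c(1)]])
  have "ev_ball d z = 0" if z: "z \<in> \<Lambda>" for z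
  proof -
    have "(\<lambda>m. ev (c (r m)) z) \<longlonglongrightarrow> ev d z"
      by (rule ev_limit[of "\<lambda>m. c (r m)", OF mult_norm_le_DA_norm_le[OF c(1)] lim]) (use z \<Lambda> in auto)
    moreover have "\<forall>\<^sub>F m in sequentially. ev (c (r m)) z = 0"
      using eventually_gt_at_top[of "to_nat_on \<Lambda> z"]
    proof eventually_elim
      case (elim m)
      have "to_nat_on \<Lambda> z < r m" using elim seq_suble[OF r, of m] by linarith
      then have "z \<notin> A (r m)" by (simp add: A_def)
      then show ?case using c(2)[OF z, of "r m"] z \<Lambda>(2) by (auto simp: ev_ball_def)
    qed
    then have "(\<lambda>m. ev (c (r m)) z) \<longlonglongrightarrow> 0"
      by (rule tendsto_eventually)
    ultimately have "ev d z = 0"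
      by (rule LIMSEQ_unique)
    then show ?thesis by (simp add: ev_ball_def)
  qed
  then have \<Phi>d: "\<Phi> (ev_ball d) = (\<lambda>x. 0)"
    using ann dm by (auto simp: v0_def Ann_def)
  have \<Phi>c: "\<Phi> (ev_ball (c m)) x = x" for m
  proof -
    have "\<Phi> (\<lambda>z. ev_ball const_one z + (-1) * ev_ball (c m) z) x = 0"
    proof (rule x)
      show "(\<lambda>z. ev_ball const_one z + (-1) * ev_ball (c m) z) \<in> multipliers"
        by (intro multipliers_add multipliers_scale one_m cm)
      have "{z\<in>\<Lambda>. ev_ball const_one z + (-1) * ev_ball (c m) z \<noteq> 0} \<subseteq> {z\<in>\<Lambda>. to_nat_on \<Lambda> z < m}"
      proof safe
        fix z assume z: "z \<in> \<Lambda>" and ne: "ev_ball const_one z + (-1) * ev_ball (c m) z \<noteq> 0"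
        have "ev_ball const_one z = 1" using z \<Lambda>(2) by (auto simp: ev_ball_def ev_const_one)
        then have "z \<notin> A m" using ne c(2)[OF z, of m] by auto
        then show "to_nat_on \<Lambda> z < m" using z by (simp add: A_def)
      qed
      moreover have "finite {z\<in>\<Lambda>. to_nat_on \<Lambda> z < m}"
        by (rule finite_imageD[of "to_nat_on \<Lambda>"], rule finite_subset[of _ "{..<m}"])
          (use inj_on_to_nat_on[OF \<Lambda>(1)] in \<open>auto simp: inj_on_def\<close>)
      ultimately show "finite {z\<in>\<Lambda>. ev_ball const_one z + (-1) * ev_ball (c m) z \<noteq> 0}"
        by (rule finite_subset)
    qed
    then show ?thesis
      using \<Phi>1 unfolding one \<Phi>add[OF one_m multipliers_scale[OF cm]] \<Phi>sc[OF cm]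
      by (simp add: cscale_def)
  qed
  \<comment> \<open>A subbasic set given by one pair of vectors, padded with zeros to sequences. It
    contains the zero operator and misses every operator that fixes \<open>x\<close>.\<close>
  define W where "W = {A\<in>BH J. (\<Sum>\<^sub>\<infinity>n. cinner J (A (if n = (0::nat) then x else 0)) (if n = 0 then x else 0)) \<in> - {cinner J x x}}"
  have "openin (weakstar_B J) W"
    unfolding weakstar_B_def
  proof (rule topology_generated_by_Basis, intro CollectI exI conjI)
    show "W = {A\<in>BH J. (\<Sum>\<^sub>\<infinity>n. cinner J (A ((\<lambda>n. if n = (0::nat) then x else 0) n)) ((\<lambda>n. if n = 0 then x else 0) n)) \<in> - {cinner J x x}}"
      by (simp add: W_def)
    show "summable (\<lambda>n. (norm (if n = (0::nat) then x else 0))\<^sup>2)"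
      by (rule summable_finite[of "{0}"]) auto
    then show "summable (\<lambda>n. (norm (if n = (0::nat) then x else 0))\<^sup>2)" .
    show "open (- {cinner J x x})" by auto
  qed
  from openin_continuous_map_preimage[OF cont this]
  have V: "openin weakstar_M {\<phi> \<in> topspace weakstar_M. \<Phi> \<phi> \<in> W}" .
  have W: "A \<in> W \<longleftrightarrow> A \<in> BH J \<and> cinner J (A x) x \<noteq> cinner J x x" for A
  proof -
    have "((\<lambda>n. cinner J (A (if n = 0 then x else 0)) (if n = 0 then x else 0)) has_sum cinner J (A x) x) (UNIV :: nat set)"
      by (rule has_sum_finite_neutralI[of "{0}"]) (auto simp: cinner_def complex_eq_iff)
    from infsumI[OF this] show ?thesis by (simp add: W_def)
  qed
  have J0: "cinner J 0 x \<noteq> cinner J x x"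
    using x0 by (simp add: cinner_def complex_eq_iff)
  \<comment> \<open>The carrier of a generated topology is the union of its generators; zero
    sequences and \<open>U = UNIV\<close> give the generator \<open>multipliers\<close>.\<close>
  have top: "\<phi> \<in> topspace weakstar_M" if "\<phi> \<in> multipliers" for \<phi> :: "complex ^ 'n \<Rightarrow> complex"
  proof -
    have "(\<lambda>\<alpha>. 0) \<in> (DA :: ('n mindex \<Rightarrow> complex) set)" by (simp add: DA_def)
    then have "openin weakstar_M (multipliers :: (complex ^ 'n \<Rightarrow> complex) set)"
      unfolding weakstar_M_def
      by (intro topology_generated_by_Basis CollectI exI[of _ "\<lambda>_ _. 0"] exI[of _ UNIV]) (simp add: danorm2_def)
    then show ?thesis using that openin_subset by fastforce
  qed
  have "ev_ball d \<in> {\<phi> \<in> topspace weakstar_M. \<Phi> \<phi> \<in> W}"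
    using J0 top[OF dm] \<Phi>BH[OF dm] by (simp add: W \<Phi>d)
  from weakstar_M_eventually[of "\<lambda>m. c (r m)", OF c(1) lim V this]
  have "\<forall>\<^sub>F m in sequentially. False"
    by eventually_elim (simp add: W \<Phi>c)
  then show False by simp
qed

section \<open>Polynomials as multipliers\<close>

abbreviation raise :: "'n \<Rightarrow> 'n mindex \<Rightarrow> 'n mindex" where
  "raise j \<beta> \<equiv> \<beta>(j := Suc (\<beta> j))"

lemma inj_raise: "inj (raise j)"
  by (rule injI) (metis fun_upd_eqD fun_upd_idem fun_upd_upd nat.inject)

text \<open>The weights have quotient \<open>(\<beta> j + 1) / (mdeg \<beta> + 1)\<close>, so
  multiplying by a coordinate does not increase the norm.\<close>

lemma daw_raise_le: "daw (raise j \<beta>) \<le> daw \<beta>"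
proof -
  have "(\<Prod>i\<in>UNIV. fact ((raise j \<beta>) i)) = real (Suc (\<beta> j)) * (\<Prod>i\<in>UNIV. fact (\<beta> i))"
    by (simp add: prod.remove[of UNIV j] algebra_simps)
  moreover have "(\<Sum>i\<in>UNIV. (raise j \<beta>) i) = Suc (\<Sum>i\<in>UNIV. \<beta> i)"
    using mdeg_upd[of \<beta> j] by (simp add: mdeg_def)
  ultimately have "daw (raise j \<beta>) = real (Suc (\<beta> j)) / real (Suc (\<Sum>i\<in>UNIV. \<beta> i)) * daw \<beta>"
    unfolding daw_def by (simp del: of_nat_Suc)
  also have "\<dots> \<le> 1 * daw \<beta>"
    using member_le_sum[of j UNIV \<beta>] daw_pos[of \<beta>]
    by (intro mult_right_mono) (auto simp: divide_le_eq_1 simp flip: of_nat_sum)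
  finally show ?thesis by simp
qed

lemma zmon_raise: "zmon z (raise j \<beta>) = z $ j * zmon z \<beta>"
  by (simp add: zmon_def prod.remove[of UNIV j])

lemma coordinate_multiplier:
  fixes j :: "'n::finite"
  shows "(\<lambda>z. if z \<in> ball_d then z $ j else 0) \<in> multipliers"
  unfolding multipliers_def
proof (intro CollectI conjI allI impI ballI)
  fix c :: "'n mindex \<Rightarrow> complex" assume c: "c \<in> DA"
  define e where "e \<gamma> = (if \<gamma> j = 0 then 0 else c (\<gamma>(j := \<gamma> j - 1)))" for \<gamma>
  have e_raise: "e (raise j \<beta>) = c \<beta>" for \<beta> by (simp add: e_def)
  have e_0: "e \<gamma> = 0" if "\<gamma> \<notin> range (raise j)" for \<gamma>
  proof (rule ccontr)
    assume "e \<gamma> \<noteq> 0"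
    then have "\<gamma> = raise j (\<gamma>(j := \<gamma> j - 1))" by (auto simp: e_def split: if_splits)
    with that show False by blast
  qed
  have "(\<lambda>\<beta>. (cmod (c \<beta>))\<^sup>2 * daw (raise j \<beta>)) summable_on UNIV"
    by (rule summable_on_comparison_test[OF c[unfolded DA_def, simplified]])
      (auto intro!: mult_left_mono daw_raise_le mult_nonneg_nonneg less_imp_le[OF daw_pos])
  then have "(\<lambda>\<gamma>. (cmod (e \<gamma>))\<^sup>2 * daw \<gamma>) summable_on range (raise j)"
    by (subst summable_on_reindex[OF inj_raise]) (simp add: o_def e_raise)
  then have "(\<lambda>\<gamma>. (cmod (e \<gamma>))\<^sup>2 * daw \<gamma>) summable_on UNIV"
    by (rule summable_on_cong_neutral[THEN iffD1, rotated -1]) (auto simp: e_0)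
  then have e: "e \<in> DA" by (simp add: DA_def)
  have "ev e z = z $ j * ev c z" if z: "z \<in> ball_d" for z
  proof -
    have "((\<lambda>\<beta>. z $ j * (c \<beta> * zmon z \<beta>)) has_sum (z $ j * ev c z)) UNIV"
      unfolding ev_def by (intro has_sum_cmult_right has_sum_infsum DA_ev_summable c z)
    then have "((\<lambda>\<gamma>. e \<gamma> * zmon z \<gamma>) has_sum (z $ j * ev c z)) (range (raise j))"
      by (subst has_sum_reindex[OF inj_raise]) (simp add: o_def e_raise zmon_raise mult.left_commute)
    then have "((\<lambda>\<gamma>. e \<gamma> * zmon z \<gamma>) has_sum (z $ j * ev c z)) UNIV"
      by (rule has_sum_cong_neutral[THEN iffD1, rotated -1]) (auto simp: e_0)
    then show ?thesis unfolding ev_def[of e] by (rule infsumI)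
  qed
  with e show "\<exists>e\<in>DA. \<forall>z\<in>ball_d. ev e z = (if z \<in> ball_d then z $ j else 0) * ev c z"
    by (intro bexI[of _ e]) auto
qed simp

lemma one_multiplier: "(\<lambda>z. if z \<in> ball_d then 1 else 0) \<in> multipliers"
  by (auto simp: multipliers_def)

lemma on_ball_power_multiplier:
  assumes "(\<lambda>z. if z \<in> ball_d then h z else 0) \<in> multipliers"
  shows "(\<lambda>z. if z \<in> ball_d then h z ^ k else 0) \<in> multipliers"
proof (induction k)
  case 0
  show ?case by (simp only: power_0 prod.empty one_multiplier)
next
  case (Suc k)
  have "(\<lambda>z. if z \<in> ball_d then h z ^ Suc k else 0)
      = (\<lambda>z. (if z \<in> ball_d then h z else 0) * (if z \<in> ball_d then h z ^ k else 0))"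
    by auto
  then show ?case using multipliers_mult[OF assms Suc.IH] by simp
qed

lemma on_ball_prod_multiplier:
  assumes "finite I" "\<And>i. i \<in> I \<Longrightarrow> (\<lambda>z. if z \<in> ball_d then h i z else 0) \<in> multipliers"
  shows "(\<lambda>z. if z \<in> ball_d then \<Prod>i\<in>I. h i z else 0) \<in> multipliers"
  using assms
proof (induction I rule: finite_induct)
  case empty
  show ?case by (simp only: power_0 prod.empty one_multiplier)
next
  case (insert i I)
  have "(\<lambda>z. if z \<in> ball_d then \<Prod>i\<in>insert i I. h i z else 0)
      = (\<lambda>z. (if z \<in> ball_d then h i z else 0) * (if z \<in> ball_d then \<Prod>i\<in>I. h i z else 0))"
    using insert.hyps by auto
  then show ?case using multipliers_mult[OF insert.prems[of i] insert.IH] insert.prems by simp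
qed

lemma sum_multiplier:
  assumes "finite I" "\<And>i. i \<in> I \<Longrightarrow> h i \<in> multipliers"
  shows "(\<lambda>z. \<Sum>i\<in>I. h i z) \<in> multipliers"
  using assms
proof (induction I rule: finite_induct)
  case empty
  then show ?case using multipliers_scale[OF one_multiplier, of 0] by simp
next
  case (insert i I)
  then show ?case using multipliers_add[of "h i" "\<lambda>z. \<Sum>i\<in>I. h i z"] by simp
qed

lemma polyfun_multiplier:
  assumes "p \<in> polys"
  shows "polyfun p \<in> multipliers"
proof -
  have "polyfun p = (\<lambda>z. \<Sum>\<alpha> | p \<alpha> \<noteq> 0. p \<alpha> * (if z \<in> ball_d then \<Prod>i\<in>UNIV. (z $ i) ^ \<alpha> i else 0))"
    by (auto simp: polyfun_def zmon_def fun_eq_iff)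
  moreover have "\<dots> \<in> multipliers"
    using assms unfolding polys_def
    by (intro sum_multiplier multipliers_scale on_ball_prod_multiplier on_ball_power_multiplier coordinate_multiplier) auto
  ultimately show ?thesis by simp
qed

definition coord_poly :: "'n \<Rightarrow> 'n mindex \<Rightarrow> complex" where
  "coord_poly j \<alpha> = (if \<alpha> = (\<lambda>i. if i = j then 1 else 0) then 1 else 0)"

lemma coord_poly_polys: "coord_poly j \<in> polys"
  by (simp add: coord_poly_def polys_def)

lemma coord_poly_support: "{\<alpha>. coord_poly j \<alpha> \<noteq> 0} = {\<lambda>i. if i = j then 1 else 0}"
  by (auto simp: coord_poly_def)

lemma polyfun_coord: "z \<in> ball_d \<Longrightarrow> polyfun (coord_poly j) z = z $ j"
  unfolding polyfun_def coord_poly_support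
  by (simp add: coord_poly_def zmon_def prod.remove[of UNIV j])

text \<open>\<open>monop\<close> composes powers along an unspecified enumeration of the indices.
  For a single coordinate all factors but one are the identity, so any order gives the same
  result.\<close>

lemma polycalc_coord:
  fixes T :: "'n::finite \<Rightarrow> 'a::real_vector \<Rightarrow> 'a"
  shows "polycalc J T (coord_poly j) = T j"
proof -
  define \<delta> :: "'n mindex" where "\<delta> = (\<lambda>i. if i = j then 1 else 0)"
  have fold: "fold (\<lambda>i f. (T i ^^ \<delta> i) \<circ> f) xs f = (if j \<in> set xs then T j \<circ> f else f)" if "distinct xs" for xs f
    using that by (induction xs arbitrary: f) (auto simp: \<delta>_def)
  have "\<exists>xs. distinct xs \<and> set xs = (UNIV :: 'n set)"
    using finite_distinct_list[OF finite] by blast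
  from someI_ex[OF this] have "distinct (SOME xs. distinct xs \<and> set xs = (UNIV :: 'n set))"
    and U: "set (SOME xs. distinct xs \<and> set xs = (UNIV :: 'n set)) = UNIV"
    by blast+
  from fold[OF this(1), of id] have "monop T \<delta> = T j"
    unfolding monop_def U by simp
  then show ?thesis
    unfolding polycalc_def coord_poly_support \<delta>_def[symmetric]
    by (simp add: coord_poly_def \<delta>_def[symmetric] cscale_def)
qed

section \<open>Bounded Boolean algebras of idempotents with one-dimensional atoms\<close>

text \<open>Averaged over all signs, the squared norm of a signed sum is the sum of the squares, so
  some signs lie at or above it (\<open>\<sigma> = -1\<close>) and some at or below
  (\<open>\<sigma> = 1\<close>). \<open>A\<close> collects the plus signs; the induction chooses
  each sign so that the cross term with \<open>inner s (y k)\<close> is favourable.\<close>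

lemma signs_norm:
  fixes y :: "'l \<Rightarrow> 'a::real_inner" and \<sigma> :: real
  assumes "finite F"
  shows "\<exists>A\<subseteq>F. \<sigma> * ((norm (sum y A - sum y (F - A)))\<^sup>2 - (\<Sum>l\<in>F. (norm (y l))\<^sup>2)) \<le> 0"
  using assms
proof (induction F rule: finite_induct)
  case empty
  then show ?case by simp
next
  case (insert k F)
  then obtain A where A: "A \<subseteq> F" "\<sigma> * ((norm (sum y A - sum y (F - A)))\<^sup>2 - (\<Sum>l\<in>F. (norm (y l))\<^sup>2)) \<le> 0"
    by blast
  define s where "s = sum y A - sum y (F - A)"
  have fin: "finite A" "k \<notin> A" using A insert.hyps finite_subset by auto
  have dp: "(norm (s + y k))\<^sup>2 = (norm s)\<^sup>2 + (norm (y k))\<^sup>2 + 2 * inner s (y k)"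
    and dm: "(norm (s - y k))\<^sup>2 = (norm s)\<^sup>2 + (norm (y k))\<^sup>2 - 2 * inner s (y k)"
    by (simp_all add: power2_norm_eq_inner inner_add_left inner_add_right inner_diff_left inner_diff_right inner_commute)
  have sum: "(\<Sum>l\<in>insert k F. (norm (y l))\<^sup>2) = (norm (y k))\<^sup>2 + (\<Sum>l\<in>F. (norm (y l))\<^sup>2)"
    using insert.hyps by simp
  show ?case
  proof (cases "\<sigma> * inner s (y k) \<le> 0")
    case True
    have plus: "sum y (insert k A) - sum y (insert k F - insert k A) = s + y k"
      using fin insert.hyps(2) by (simp add: s_def)
    have "\<sigma> * ((norm (s + y k))\<^sup>2 - (\<Sum>l\<in>insert k F. (norm (y l))\<^sup>2)) \<le> 0"
      using True A(2) unfolding dp sum s_def[symmetric] by (simp add: algebra_simps)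
    then show ?thesis
      using A(1) unfolding plus[symmetric] by (intro exI[of _ "insert k A"]) auto
  next
    case False
    have minus: "sum y A - sum y (insert k F - A) = s - y k"
      using fin insert.hyps by (simp add: s_def insert_Diff_if)
    have "\<sigma> * ((norm (s - y k))\<^sup>2 - (\<Sum>l\<in>insert k F. (norm (y l))\<^sup>2)) \<le> 0"
      using False A(2) unfolding dm sum s_def[symmetric] by (simp add: algebra_simps)
    then show ?thesis
      using A(1) unfolding minus[symmetric] by (intro exI[of _ A]) auto
  qed
qed

text \<open>On \<open>L\<close>, the vector \<open>u l\<close> spans the range of
  \<open>P {l}\<close> over the complex numbers and is 0 exactly when this atom vanishes.
  \<open>rank_one\<close> is the expansion x = <x, u> u on that range, its second term carrying the
  imaginary part of the inner product. The idempotents may be oblique, and \<open>K\<close> bounds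
  how much.\<close>

locale atomic_system =
  fixes J :: "'a::{real_inner, complete_space} \<Rightarrow> 'a" and P :: "'l set \<Rightarrow> 'a \<Rightarrow> 'a"
    and L :: "'l set" and K :: real and u :: "'l \<Rightarrow> 'a"
  assumes J: "cstruct J"
    and P_linear: "bounded_linear (P A)"
    and P_J: "P A (J x) = J (P A x)"
    and P_P: "P A (P B x) = P (A \<inter> B) x"
    and P_Un: "A \<inter> B = {} \<Longrightarrow> P (A \<union> B) x = P A x + P B x"
    and P_bound: "norm (P A x) \<le> K * norm x"
    and separating: "(\<And>l. l \<in> L \<Longrightarrow> P {l} x = 0) \<Longrightarrow> x = 0"
    and countable: "countable L"
    and u_norm: "u l \<noteq> 0 \<Longrightarrow> norm (u l) = 1"
    and P_u: "l \<in> L \<Longrightarrow> P {l} (u l) = u l"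
    and rank_one: "l \<in> L \<Longrightarrow>
      P {l} x = inner (P {l} x) (u l) *\<^sub>R u l + inner (P {l} x) (J (u l)) *\<^sub>R J (u l)"
begin

lemma J_linear: "linear J" and J_J: "J (J x) = - x" and J_inner: "inner (J x) (J y) = inner x y"
  using J by (auto simp: cstruct_def)

lemma inner_J_left: "inner (J x) y = - inner x (J y)"
  using J_inner[of "J x" y] by (simp add: J_J)

lemma P_empty: "P {} x = 0"
  using P_Un[of "{}" "{}" x] by simp

lemma P_finite: "finite F \<Longrightarrow> P F x = (\<Sum>l\<in>F. P {l} x)"
proof (induction F rule: finite_induct)
  case (insert k F)
  then show ?case using P_Un[of "{k}" F x] by simp
qed (simp add: P_empty)

lemma separate: "(\<And>l. l \<in> L \<Longrightarrow> P {l} x = P {l} y) \<Longrightarrow> x = y"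
  using separating[of "x - y"] bounded_linear.linear[OF P_linear, THEN linear_diff] by force

lemma sign_change_bound: "norm (P A x - P B x) \<le> 2 * K * norm x"
  using P_bound[of A x] P_bound[of B x] norm_triangle_ineq4[of "P A x" "P B x"] by linarith

text \<open>Signs are chosen to make the signed sum of the components large; this signed sum is
  \<open>P A x - P (F - A) x\<close>.\<close>

lemma components_square_sum:
  assumes "finite F"
  shows "(\<Sum>l\<in>F. (norm (P {l} x))\<^sup>2) \<le> (2 * K * norm x)\<^sup>2"
proof -
  obtain A where A: "A \<subseteq> F" "(\<Sum>l\<in>F. (norm (P {l} x))\<^sup>2)
      \<le> (norm ((\<Sum>l\<in>A. P {l} x) - (\<Sum>l\<in>F - A. P {l} x)))\<^sup>2"
    using signs_norm[OF assms, of "-1" "\<lambda>l. P {l} x"] by auto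
  have "finite A" "finite (F - A)" using A(1) assms finite_subset by auto
  then have "(\<Sum>l\<in>A. P {l} x) - (\<Sum>l\<in>F - A. P {l} x) = P A x - P (F - A) x"
    by (simp only: P_finite)
  then have "(\<Sum>l\<in>F. (norm (P {l} x))\<^sup>2) \<le> (norm (P A x - P (F - A) x))\<^sup>2"
    using A(2) by simp
  also have "\<dots> \<le> (2 * K * norm x)\<^sup>2"
    by (intro power_mono sign_change_bound norm_ge_zero)
  finally show ?thesis .
qed

text \<open>For this opposite estimate signs are chosen to make the signed sum \<open>s\<close>
  small, and \<open>P A - P (F - A)\<close> turns \<open>s\<close> back into the unsigned
  sum.\<close>

lemma norm_sum_components:
  assumes F: "finite F" and y: "\<And>l. l \<in> F \<Longrightarrow> P {l} (y l) = y l"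
  shows "(norm (sum y F))\<^sup>2 \<le> (2 * K)\<^sup>2 * (\<Sum>l\<in>F. (norm (y l))\<^sup>2)"
proof -
  obtain A where A: "A \<subseteq> F" "(norm (sum y A - sum y (F - A)))\<^sup>2 \<le> (\<Sum>l\<in>F. (norm (y l))\<^sup>2)"
    using signs_norm[OF F, of 1 y] by auto
  have PB: "P B (y l) = (if l \<in> B then y l else 0)" if "l \<in> F" for l B
    using y[OF that] P_P[of B "{l}" "y l"] by (auto simp: P_empty)
  have PBC: "P B (sum y C) = sum y (B \<inter> C)" if "C \<subseteq> F" for B C
  proof -
    have C: "finite C" using that F finite_subset by blast
    have "P B (sum y C) = (\<Sum>l\<in>C. P B (y l))"
      by (rule linear_sum[OF bounded_linear.linear[OF P_linear]])
    also have "\<dots> = (\<Sum>l\<in>C. if l \<in> B then y l else 0)"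
      using that by (intro sum.cong) (auto simp: PB)
    also have "\<dots> = sum y (B \<inter> C)"
      using C by (simp add: sum.inter_restrict[symmetric] Int_commute)
    finally show ?thesis .
  qed
  define s where "s = sum y A - sum y (F - A)"
  have FA: "A \<inter> A = A" "A \<inter> (F - A) = {}" "(F - A) \<inter> A = {}" "(F - A) \<inter> (F - A) = F - A" by auto
  have "P A s - P (F - A) s = sum y A + sum y (F - A)"
    using A(1) unfolding s_def linear_diff[OF bounded_linear.linear[OF P_linear]]
    by (simp add: PBC FA)
  also have "\<dots> = sum y F"
    using sum.subset_diff[OF A(1) F, of y] by (simp add: add.commute)
  finally have "(norm (sum y F))\<^sup>2 \<le> (2 * K * norm s)\<^sup>2"
    using sign_change_bound[of A s "F - A"] by (intro power_mono) auto
  also have "\<dots> \<le> (2 * K)\<^sup>2 * (\<Sum>l\<in>F. (norm (y l))\<^sup>2)"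
    using A(2) unfolding power_mult_distrib s_def by (intro mult_left_mono) auto
  finally show ?thesis .
qed

text \<open>A Riesz-Fischer theorem for the atoms: \<open>norm_sum_components\<close> makes the
  partial sums Cauchy. The absolute value is taken because the locale fixes no sign of
  \<open>K\<close>, which can be negative on the zero space.\<close>

lemma synthesis:
  assumes y: "\<And>l. l \<in> L \<Longrightarrow> P {l} (y l) = y l"
    and B: "\<And>F. finite F \<Longrightarrow> F \<subseteq> L \<Longrightarrow> (\<Sum>l\<in>F. (norm (y l))\<^sup>2) \<le> B\<^sup>2" and B0: "0 \<le> B"
  shows "\<exists>w. (\<forall>l\<in>L. P {l} w = y l) \<and> norm w \<le> \<bar>2 * K\<bar> * B"
proof -
  define F where "F n = {l\<in>L. to_nat_on L l < n}" for n
  have F: "finite (F n)" "F n \<subseteq> L" for n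
  proof -
    show "finite (F n)"
      by (rule finite_imageD[of "to_nat_on L"], rule finite_subset[of _ "{..<n}"])
        (use inj_on_to_nat_on[OF countable] in \<open>auto simp: F_def inj_on_def\<close>)
  qed (auto simp: F_def)
  have F_mono: "F m \<subseteq> F n" if "m \<le> n" for m n using that by (auto simp: F_def)
  define q where "q n = (\<Sum>l\<in>F n. (norm (y l))\<^sup>2)" for n
  have "convergent q"
  proof (rule Bseq_mono_convergent)
    have "q n \<in> {0..B\<^sup>2}" for n
      using B[OF F(1) F(2)] by (auto simp: q_def sum_nonneg)
    then show "Bseq q" by (intro BseqI'[of _ "B\<^sup>2"]) auto
    have "q m \<le> q n" if "m \<le> n" for m n
      unfolding q_def using F_mono[OF that] F by (intro sum_mono2) auto
    then show "\<forall>m. \<forall>n\<ge>m. q m \<le> q n" by blast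
  qed
  then have Cq: "Cauchy q" by (rule convergent_Cauchy)
  define S where "S n = sum y (F n)" for n
  have diff: "(norm (S n - S m))\<^sup>2 \<le> (2 * K)\<^sup>2 * (q n - q m)" if "m \<le> n" for m n
  proof -
    have "S n - S m = sum y (F n - F m)" "q n - q m = (\<Sum>l\<in>F n - F m. (norm (y l))\<^sup>2)"
      unfolding S_def q_def by (simp_all add: sum_diff[OF F(1) F_mono[OF that]])
    then show ?thesis
      using norm_sum_components[of "F n - F m" y] F[of n] y by auto
  qed
  have "Cauchy S"
  proof (rule CauchyI')
    fix e :: real assume e: "0 < e"
    \<comment> \<open>The \<open>+ 1\<close> keeps the denominator positive when
      \<open>K = 0\<close>.\<close>
    define \<epsilon> where "\<epsilon> = e\<^sup>2 / ((2 * K)\<^sup>2 + 1)"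
    have pos: "0 < (2 * K)\<^sup>2 + 1" by (smt (verit) zero_le_power2)
    then have \<epsilon>: "0 < \<epsilon>" using e by (simp add: \<epsilon>_def)
    obtain M where M: "\<And>m n. m \<ge> M \<Longrightarrow> n \<ge> M \<Longrightarrow> dist (q m) (q n) < \<epsilon>"
      using Cq \<epsilon> unfolding Cauchy_def by blast
    have "norm (S m - S n) < e" if "m \<ge> M" "n > m" for m n
    proof -
      have "(norm (S n - S m))\<^sup>2 \<le> (2 * K)\<^sup>2 * (q n - q m)" using diff that by simp
      also have "\<dots> \<le> (2 * K)\<^sup>2 * \<epsilon>"
        using M[of m n] that by (intro mult_left_mono) (auto simp: dist_real_def)
      also have "\<dots> < ((2 * K)\<^sup>2 + 1) * \<epsilon>" using \<epsilon> by (simp add: algebra_simps)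
      also have "\<dots> = e\<^sup>2" using pos by (simp add: \<epsilon>_def)
      finally show ?thesis using e by (simp add: norm_minus_commute power2_less_imp_less)
    qed
    then show "\<exists>M. \<forall>m\<ge>M. \<forall>n>m. dist (S m) (S n) < e" by (auto simp: dist_norm)
  qed
  then obtain w where w: "S \<longlonglongrightarrow> w"
    using Cauchy_convergent convergent_def by blast
  have "P {l} w = y l" if l: "l \<in> L" for l
  proof -
    have "(\<lambda>n. P {l} (S n)) \<longlonglongrightarrow> P {l} w"
      by (rule bounded_linear.tendsto[OF P_linear w])
    moreover have "\<forall>\<^sub>F n in sequentially. P {l} (S n) = y l"
      using eventually_gt_at_top[of "to_nat_on L l"]
    proof eventually_elim
      case (elim n)
      have "P {l} (S n) = (\<Sum>k\<in>F n. P {l} (y k))"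
        unfolding S_def by (rule linear_sum[OF bounded_linear.linear[OF P_linear]])
      also have "\<dots> = (\<Sum>k\<in>F n. if k = l then y k else 0)"
      proof (rule sum.cong)
        fix k assume "k \<in> F n"
        then have "P {l} (y k) = P ({l} \<inter> {k}) (y k)"
          using y[of k] P_P[of "{l}" "{k}" "y k"] F(2)[of n] by (metis subsetD)
        then show "P {l} (y k) = (if k = l then y k else 0)"
          using y l by (auto simp: P_empty)
      qed simp
      also have "\<dots> = y l" using F(1)[of n] elim l by (simp add: F_def)
      finally show ?case .
    qed
    then have "(\<lambda>n. P {l} (S n)) \<longlonglongrightarrow> y l" by (rule tendsto_eventually)
    ultimately show ?thesis by (rule LIMSEQ_unique)
  qed
  moreover have "norm w \<le> \<bar>2 * K\<bar> * B"
  proof (rule LIMSEQ_le_const2[OF tendsto_norm[OF w]], intro exI allI impI)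
    fix n
    have "(norm (S n))\<^sup>2 \<le> (2 * K)\<^sup>2 * (\<Sum>l\<in>F n. (norm (y l))\<^sup>2)"
      unfolding S_def using F[of n] y by (intro norm_sum_components) auto
    also have "\<dots> \<le> (2 * K)\<^sup>2 * B\<^sup>2"
      using B F by (intro mult_left_mono) auto
    also have "\<dots> = (\<bar>2 * K\<bar> * B)\<^sup>2" by (simp add: power_mult_distrib)
    finally show "norm (S n) \<le> \<bar>2 * K\<bar> * B"
      using B0 by (intro power2_le_imp_le[of "norm (S n)"]) auto
  qed
  ultimately show ?thesis by blast
qed

end

section \<open>Intertwining maps between two atomic systems\<close>

text \<open>The complex-linear map y \<mapsto> <y, v> u, written with the real inner product; the
  imaginary part acts through \<open>J1\<close>.\<close>

definition rank_one_map :: "('b::real_inner \<Rightarrow> 'b) \<Rightarrow> 'b \<Rightarrow> ('a::real_vector \<Rightarrow> 'a) \<Rightarrow> 'a \<Rightarrow> 'b \<Rightarrow> 'a" where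
  "rank_one_map J2 v J1 u y = inner y v *\<^sub>R u + inner y (J2 v) *\<^sub>R J1 u"

text \<open>The components of \<open>X x\<close> are prescribed atom by atom and assembled by
  \<open>synthesis\<close>, with the square sum estimate of the source system as input. Linearity
  and compatibility with the complex structures follow from uniqueness, by
  \<open>separate\<close>.\<close>

lemma intertwiner_exists:
  fixes J1 :: "'a::{real_inner, complete_space} \<Rightarrow> 'a" and J2 :: "'b::{real_inner, complete_space} \<Rightarrow> 'b"
  assumes "atomic_system J1 P L K1 u" "atomic_system J2 Q L K2 v"
  shows "\<exists>X. bcl J2 J1 X \<and> (\<forall>l\<in>L. \<forall>x. P {l} (X x) = rank_one_map J2 (v l) J1 (u l) (Q {l} x))"
proof -
  interpret a: atomic_system J1 P L K1 u by fact
  interpret b: atomic_system J2 Q L K2 v by fact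
  let ?w = "\<lambda>l. rank_one_map J2 (v l) J1 (u l)"
  have w_linear: "linear (?w l)" for l
    by (rule linearI) (simp_all add: rank_one_map_def inner_add_left algebra_simps)
  have w_J: "?w l (J2 y) = J1 (?w l y)" for l y
    by (simp add: rank_one_map_def b.inner_J_left b.J_inner b.J_J a.J_J linear_add[OF a.J_linear]
        linear_cmul[OF a.J_linear])
  have Pw: "P {l} (?w l y) = ?w l y" if "l \<in> L" for l y
  proof -
    have lin: "linear (P {l})" by (rule bounded_linear.linear[OF a.P_linear])
    show ?thesis
      by (simp add: rank_one_map_def linear_add[OF lin] linear_cmul[OF lin] a.P_J a.P_u[OF that])
  qed
  have nJ: "norm (J1 x) = norm x" "norm (J2 y) = norm y" for x y
    by (simp_all add: norm_eq_sqrt_inner a.J_inner b.J_inner)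
  have nu: "norm (u l) \<le> 1" "norm (v l) \<le> 1" for l
    using a.u_norm[of l] b.u_norm[of l] by (cases "u l = 0"; cases "v l = 0"; simp)+
  have w_norm: "norm (?w l y) \<le> 2 * norm y" for l y
  proof -
    have i: "\<bar>inner y (v l)\<bar> \<le> norm y" "\<bar>inner y (J2 (v l))\<bar> \<le> norm y"
      using Cauchy_Schwarz_ineq2[of y "v l"] Cauchy_Schwarz_ineq2[of y "J2 (v l)"] nu(2)[of l]
        mult_left_mono[of "norm (v l)" 1 "norm y"] by (auto simp: nJ)
    have "norm (?w l y) \<le> \<bar>inner y (v l)\<bar> * norm (u l) + \<bar>inner y (J2 (v l))\<bar> * norm (u l)"
      unfolding rank_one_map_def using norm_triangle_ineq[of "inner y (v l) *\<^sub>R u l" "inner y (J2 (v l)) *\<^sub>R J1 (u l)"]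
      by (simp add: nJ)
    also have "\<dots> \<le> norm y * 1 + norm y * 1"
      using i nu(1)[of l] by (intro add_mono mult_mono) auto
    finally show ?thesis by simp
  qed
  have "\<exists>z. (\<forall>l\<in>L. P {l} z = ?w l (Q {l} x)) \<and> norm z \<le> \<bar>2 * K1\<bar> * (2 * \<bar>2 * K2 * norm x\<bar>)" for x
  proof (rule a.synthesis)
    fix F assume F: "finite F" "F \<subseteq> L"
    have "(\<Sum>l\<in>F. (norm (?w l (Q {l} x)))\<^sup>2) \<le> (\<Sum>l\<in>F. 2\<^sup>2 * (norm (Q {l} x))\<^sup>2)"
      unfolding power_mult_distrib[symmetric] using w_norm by (intro sum_mono power_mono) auto
    also have "\<dots> \<le> 2\<^sup>2 * (2 * K2 * norm x)\<^sup>2"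
      unfolding sum_distrib_left[symmetric] using b.components_square_sum[OF F(1)]
      by (intro mult_left_mono) auto
    finally show "(\<Sum>l\<in>F. (norm (?w l (Q {l} x)))\<^sup>2) \<le> (2 * \<bar>2 * K2 * norm x\<bar>)\<^sup>2"
      by (simp add: power_mult_distrib)
  qed (simp_all add: Pw)
  then obtain X where X: "\<And>x l. l \<in> L \<Longrightarrow> P {l} (X x) = ?w l (Q {l} x)"
    and Xn: "\<And>x. norm (X x) \<le> \<bar>2 * K1\<bar> * (2 * \<bar>2 * K2 * norm x\<bar>)"
    by metis
  have linP: "linear (P A)" and linQ: "linear (Q A)" for A
    by (intro bounded_linear.linear a.P_linear b.P_linear)+
  have "bounded_linear X"
  proof (rule bounded_linear_intro)
    show "X (x + y) = X x + X y" for x y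
      by (rule a.separate) (simp add: X linear_add[OF linP] linear_add[OF linQ] linear_add[OF w_linear])
    show "X (r *\<^sub>R x) = r *\<^sub>R X x" for r x
      by (rule a.separate) (simp add: X linear_cmul[OF linP] linear_cmul[OF linQ] linear_cmul[OF w_linear])
    show "norm (X x) \<le> norm x * (\<bar>2 * K1\<bar> * (2 * \<bar>2 * K2\<bar>))" for x
      using Xn[of x] by (simp add: abs_mult algebra_simps)
  qed
  moreover have "X (J2 x) = J1 (X x)" for x
    by (rule a.separate) (simp add: X a.P_J b.P_J w_J)
  ultimately show ?thesis using X by (auto simp: bcl_def)
qed

lemma (in atomic_system) rank_one_map_inverse:
  assumes "l \<in> L" and uv: "u l = 0 \<longleftrightarrow> v = 0" and v: "v \<noteq> 0 \<Longrightarrow> norm v = 1" and J': "cstruct J'"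
  shows "rank_one_map J' v J (u l) (rank_one_map J (u l) J' v (P {l} x)) = P {l} x"
proof (cases "v = 0")
  case True
  then have "u l = 0" using uv by simp
  moreover have "J 0 = 0" by (rule linear_0[OF J_linear])
  ultimately show ?thesis using rank_one[OF assms(1), of x] True
    by (simp add: rank_one_map_def)
next
  case False
  have vv: "inner v v = 1" using v[OF False] by (simp add: power2_norm_eq_inner[symmetric])
  have J'i: "inner (J' x) (J' y) = inner x y" "J' (J' x) = - x" for x y using J' by (auto simp: cstruct_def)
  have v0: "inner (J' v) v = 0" "inner v (J' v) = 0"
    using J'i(1)[of "J' v" v] J'i(2)[of v] by (simp_all add: inner_commute)
  show ?thesis
    using rank_one[OF assms(1), of x]
    by (simp add: rank_one_map_def inner_add_left vv v0 J'i)
qed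

section \<open>The functional calculus on an interpolating sequence\<close>

lemma norm_cscale:
  assumes "cstruct J"
  shows "norm (cscale J k x) = cmod k * norm x"
proof -
  have J: "inner (J x) (J y) = inner x y" "J (J x) = - x" for x y
    using assms by (auto simp: cstruct_def)
  have "inner x (J x) = 0" using J(1)[of "J x" x] J(2)[of x] by (simp add: inner_commute)
  then have "(norm (cscale J k x))\<^sup>2 = ((Re k)\<^sup>2 + (Im k)\<^sup>2) * (norm x)\<^sup>2"
    unfolding power2_norm_eq_inner cscale_def
    by (simp add: inner_add_left inner_add_right J inner_commute power2_eq_square algebra_simps)
  also have "\<dots> = (cmod k * norm x)\<^sup>2" by (simp add: cmod_power2 power_mult_distrib)
  finally show ?thesis by (simp add: power2_eq_iff_nonneg)
qed

lemma calculus_cong: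
  assumes \<Phi>: "ac_calculus J T \<Phi>" and ann: "v0 \<Lambda> \<subseteq> Ann \<Phi>"
    and "\<phi> \<in> multipliers" "\<psi> \<in> multipliers" and eq: "\<And>z. z \<in> \<Lambda> \<Longrightarrow> \<phi> z = \<psi> z"
  shows "\<Phi> \<phi> = \<Phi> \<psi>"
proof -
  have m: "(\<lambda>z. (-1) * \<psi> z) \<in> multipliers" by (intro multipliers_scale assms)
  have "(\<lambda>z. \<phi> z + (-1) * \<psi> z) \<in> v0 \<Lambda>"
    using multipliers_add[OF assms(3) m] eq by (simp add: v0_def)
  then have "\<Phi> (\<lambda>z. \<phi> z + (-1) * \<psi> z) = (\<lambda>x. 0)"
    using ann by (auto simp: Ann_def)
  then show ?thesis
    unfolding ac_calculus_add[OF \<Phi> assms(3) m] ac_calculus_scale[OF \<Phi> assms(4)]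
    by (simp add: fun_eq_iff cscale_def)
qed

text \<open>Now \<open>R f K\<close> bounds the operator of some interpolant instead of its
  multiplier norm: every operator of the calculus is individually bounded, and the hump argument
  makes the bound uniform over indicators.\<close>

lemma calculus_indicators_bounded:
  assumes J: "cstruct J" and \<Phi>: "ac_calculus J T \<Phi>"
    and \<Lambda>: "interpolating \<Lambda>"
  shows "\<exists>K. \<forall>A. 0 \<le> K \<and> (\<exists>\<phi>\<in>multipliers. (\<forall>z\<in>\<Lambda>. \<phi> z = indicator A z) \<and> (\<forall>x. norm (\<Phi> \<phi> x) \<le> K * norm x))"
proof (rule indicators_uniformly_bounded[where L = \<Lambda> and
      R = "\<lambda>f K. 0 \<le> K \<and> (\<exists>\<phi>\<in>multipliers. (\<forall>z\<in>\<Lambda>. \<phi> z = f z) \<and> (\<forall>x. norm (\<Phi> \<phi> x) \<le> K * norm x))"], goal_cases)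
  case (1 f)
  then obtain \<phi> where \<phi>: "\<phi> \<in> multipliers" "\<forall>z\<in>\<Lambda>. \<phi> z = f z"
    using \<Lambda> by (auto simp: interpolating_def)
  have "bounded_linear (\<Phi> \<phi>)" using ac_calculus_BH[OF \<Phi> \<phi>(1)] by (simp add: BH_def)
  then obtain K where "0 < K" "\<And>x. norm (\<Phi> \<phi> x) \<le> norm x * K"
    using bounded_linear.pos_bounded by blast
  then show ?case using \<phi> by (intro exI[of _ K]) (auto simp: mult.commute)
next
  case (2 f g K)
  then show ?case by auto
next
  case (3 f K)
  then show ?case by blast
next
  case (4 f K K')
  then obtain \<phi> where \<phi>: "\<phi> \<in> multipliers" "\<forall>z\<in>\<Lambda>. \<phi> z = f z" "\<And>x. norm (\<Phi> \<phi> x) \<le> K * norm x" "0 \<le> K" by blast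
  have "norm (\<Phi> \<phi> x) \<le> K' * norm x" for x
    using \<phi>(3)[of x] mult_right_mono[OF 4(2), of "norm x"] by simp
  then show ?case using \<phi> 4(2) by auto
next
  case (5 f g K M)
  then obtain \<phi> \<psi> where \<phi>: "\<phi> \<in> multipliers" "\<forall>z\<in>\<Lambda>. \<phi> z = f z" "\<And>x. norm (\<Phi> \<phi> x) \<le> K * norm x" "0 \<le> K"
    and \<psi>: "\<psi> \<in> multipliers" "\<forall>z\<in>\<Lambda>. \<psi> z = g z" "\<And>x. norm (\<Phi> \<psi> x) \<le> M * norm x" "0 \<le> M" by blast
  have "norm (\<Phi> (\<lambda>z. \<phi> z + \<psi> z) x) \<le> (K + M) * norm x" for x
    unfolding ac_calculus_add[OF \<Phi> \<phi>(1) \<psi>(1)] distrib_right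
    using \<phi>(3)[of x] \<psi>(3)[of x] by (rule norm_triangle_mono)
  then show ?case using \<phi> \<psi> multipliers_add[OF \<phi>(1) \<psi>(1)]
    by (intro conjI bexI[of _ "\<lambda>z. \<phi> z + \<psi> z"]) auto
next
  case (6 f g K M)
  then obtain \<phi> \<psi> where \<phi>: "\<phi> \<in> multipliers" "\<forall>z\<in>\<Lambda>. \<phi> z = f z" "\<And>x. norm (\<Phi> \<phi> x) \<le> K * norm x" "0 \<le> K"
    and \<psi>: "\<psi> \<in> multipliers" "\<forall>z\<in>\<Lambda>. \<psi> z = g z" "\<And>x. norm (\<Phi> \<psi> x) \<le> M * norm x" "0 \<le> M" by blast
  have "norm (\<Phi> (\<lambda>z. \<phi> z * \<psi> z) x) \<le> (K * M) * norm x" for x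
    unfolding ac_calculus_mult[OF \<Phi> \<phi>(1) \<psi>(1)] o_apply
    using \<phi>(3)[of "\<Phi> \<psi> x"] mult_left_mono[OF \<psi>(3)[of x] \<phi>(4)] by (simp add: mult.assoc)
  then show ?case using \<phi> \<psi> multipliers_mult[OF \<phi>(1) \<psi>(1)]
    by (intro conjI bexI[of _ "\<lambda>z. \<phi> z * \<psi> z"]) auto
next
  case (7 f K k)
  then obtain \<phi> where \<phi>: "\<phi> \<in> multipliers" "\<forall>z\<in>\<Lambda>. \<phi> z = f z" "\<And>x. norm (\<Phi> \<phi> x) \<le> K * norm x" "0 \<le> K" by blast
  have "norm (\<Phi> (\<lambda>z. k * \<phi> z) x) \<le> (cmod k * K) * norm x" for x
    unfolding ac_calculus_scale[OF \<Phi> \<phi>(1)] norm_cscale[OF J]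
    using mult_left_mono[OF \<phi>(3)[of x], of "cmod k"] by (simp add: mult.assoc)
  then show ?case using \<phi> multipliers_scale[OF \<phi>(1), of k]
    by (intro conjI bexI[of _ "\<lambda>z. k * \<phi> z"]) auto
qed

text \<open>\<open>\<rho>\<close> is given from outside so that two calculi obtain their atoms from
  the same multipliers. On \<Lambda>, a polynomial times the indicator of \<open>{l}\<close> is the
  value at \<open>l\<close> times that indicator. So polynomials act on the atom as scalars, and the
  dense cyclic orbit confines its range to one complex line.\<close>

lemma calculus_atomic_system:
  fixes J :: "'a::{real_inner, complete_space} \<Rightarrow> 'a" and \<Lambda> :: "(complex ^ 'n::finite) set"
  assumes J: "cstruct J" and \<Phi>: "ac_calculus J T \<Phi>" and cyc: "cyclic J T"
    and \<Lambda>: "countable \<Lambda>" "\<Lambda> \<subseteq> ball_d" "interpolating \<Lambda>" and ann: "v0 \<Lambda> \<subseteq> Ann \<Phi>"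
    and \<rho>: "\<And>A. \<rho> A \<in> multipliers" "\<And>A z. z \<in> \<Lambda> \<Longrightarrow> \<rho> A z = indicator A z"
  obtains K u where "atomic_system J (\<lambda>A. \<Phi> (\<rho> A)) \<Lambda> K u"
    and "\<And>l j x. l \<in> \<Lambda> \<Longrightarrow> \<Phi> (\<rho> {l}) (T j x) = cscale J (l $ j) (\<Phi> (\<rho> {l}) x)"
proof -
  define P where "P A = \<Phi> (\<rho> A)" for A
  note cong = calculus_cong[OF \<Phi> ann]
  have BH: "bounded_linear (P A)" "P A (J x) = J (P A x)" for A x
    using ac_calculus_BH[OF \<Phi> \<rho>(1)[of A]] by (auto simp: BH_def P_def)
  have P_P: "P A (P B x) = P (A \<inter> B) x" for A B x
  proof -
    have "\<Phi> (\<lambda>z. \<rho> A z * \<rho> B z) = P (A \<inter> B)"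
      unfolding P_def by (rule cong) (auto intro: multipliers_mult \<rho>(1) simp: \<rho>(2) indicator_def)
    then show ?thesis
      unfolding ac_calculus_mult[OF \<Phi> \<rho>(1) \<rho>(1)] by (auto simp: P_def fun_eq_iff)
  qed
  have P_Un: "P (A \<union> B) x = P A x + P B x" if "A \<inter> B = {}" for A B x
  proof -
    have "\<Phi> (\<lambda>z. \<rho> A z + \<rho> B z) = P (A \<union> B)"
      unfolding P_def by (rule cong) (use that in \<open>auto intro: multipliers_add \<rho>(1) simp: \<rho>(2) indicator_def\<close>)
    then show ?thesis
      unfolding ac_calculus_add[OF \<Phi> \<rho>(1) \<rho>(1)] by (auto simp: P_def fun_eq_iff)
  qed
  obtain K where K: "\<And>A. \<exists>\<phi>\<in>multipliers. (\<forall>z\<in>\<Lambda>. \<phi> z = indicator A z) \<and> (\<forall>x. norm (\<Phi> \<phi> x) \<le> K * norm x)"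
    using calculus_indicators_bounded[OF J \<Phi> \<Lambda>(3)] by blast
  have P_bound: "norm (P A x) \<le> K * norm x" for A x
  proof -
    obtain \<phi> where \<phi>: "\<phi> \<in> multipliers" "\<forall>z\<in>\<Lambda>. \<phi> z = indicator A z" "\<forall>x. norm (\<Phi> \<phi> x) \<le> K * norm x"
      using K[of A] by blast
    have "P A = \<Phi> \<phi>"
      unfolding P_def by (rule cong) (use \<phi> in \<open>auto simp: \<rho>\<close>)
    then show ?thesis using \<phi>(3) by simp
  qed
  have sep: "x = 0" if x: "\<And>l. l \<in> \<Lambda> \<Longrightarrow> P {l} x = 0" for x
  proof (rule finitely_supported_multipliers_separate[OF \<Lambda> \<Phi> ann])
    fix \<phi> :: "complex ^ 'n \<Rightarrow> complex"
    assume \<phi>: "\<phi> \<in> multipliers" and fin: "finite {z\<in>\<Lambda>. \<phi> z \<noteq> 0}"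
    have P0: "P F x = 0" if "finite F" "F \<subseteq> \<Lambda>" for F
      using that
    proof (induction F rule: finite_induct)
      case empty
      then show ?case using P_Un[of "{}" "{}" x] by simp
    next
      case (insert k F)
      then show ?case using P_Un[of "{k}" F x] x[of k] by simp
    qed
    \<comment> \<open>On \<Lambda>, \<open>\<phi>\<close> equals its product with the indicator of
      its support, and the idempotent of this finite support is a sum of atoms.\<close>
    have "\<Phi> (\<lambda>z. \<phi> z * \<rho> {z\<in>\<Lambda>. \<phi> z \<noteq> 0} z) = \<Phi> \<phi>"
      by (rule cong) (use \<phi> in \<open>auto intro: multipliers_mult \<rho>(1) simp: \<rho>(2) indicator_def\<close>)
    then have "\<Phi> \<phi> x = \<Phi> \<phi> (P {z\<in>\<Lambda>. \<phi> z \<noteq> 0} x)"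
      unfolding ac_calculus_mult[OF \<Phi> \<phi> \<rho>(1)] by (metis P_def o_apply)
    also have "\<dots> = 0"
      using ac_calculus_BH[OF \<Phi> \<phi>] P0[OF fin] by (simp add: BH_def bounded_linear.linear linear_0)
    finally show "\<Phi> \<phi> x = 0" .
  qed
  have P_poly: "P {l} (polycalc J T p x) = cscale J (polyfun p l) (P {l} x)" if l: "l \<in> \<Lambda>" and p: "p \<in> polys" for l p x
  proof -
    have "\<Phi> (\<lambda>z. \<rho> {l} z * polyfun p z) = \<Phi> (\<lambda>z. polyfun p l * \<rho> {l} z)"
      by (rule cong) (auto intro: multipliers_mult multipliers_scale \<rho>(1) polyfun_multiplier p simp: \<rho>(2) indicator_def)
    then show ?thesis
      unfolding ac_calculus_mult[OF \<Phi> \<rho>(1) polyfun_multiplier[OF p]] ac_calculus_scale[OF \<Phi> \<rho>(1)]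
        ac_calculus_poly[OF \<Phi> p]
      by (auto simp: P_def fun_eq_iff)
  qed
  obtain \<xi> where \<xi>: "closure {polycalc J T p \<xi> | p. p \<in> polys} = UNIV"
    using cyc by (auto simp: cyclic_def)
  \<comment> \<open>The component of the cyclic vector in the atom, normalised; if the component is
    0, then so is \<open>u l\<close>.\<close>
  define u where "u l = inverse (norm (P {l} \<xi>)) *\<^sub>R P {l} \<xi>" for l
  have J': "linear J" "\<And>x y. inner (J x) (J y) = inner x y" "\<And>x. J (J x) = - x"
    using J by (auto simp: cstruct_def)
  have contJ: "continuous_on UNIV J"
  proof -
    have "norm (J x) = norm x" for x by (simp add: norm_eq_sqrt_inner J')
    then have "bounded_linear J"
      using J'(1) by (intro bounded_linear_intro[where K = 1]) (auto simp: linear_add linear_cmul)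
    then show ?thesis by (rule bounded_linear.continuous_on) (rule continuous_on_id)
  qed
  have rank: "P {l} x = inner (P {l} x) (u l) *\<^sub>R u l + inner (P {l} x) (J (u l)) *\<^sub>R J (u l)" if l: "l \<in> \<Lambda>" for l x
  proof -
    let ?R = "\<lambda>x. inner (P {l} x) (u l) *\<^sub>R u l + inner (P {l} x) (J (u l)) *\<^sub>R J (u l)"
    have cont: "continuous_on UNIV (P {l})"
      by (rule bounded_linear.continuous_on[OF BH(1)]) (rule continuous_on_id)
    \<comment> \<open>The expansion can be computed on the orbit of \<xi>, where the components are
      multiples of \<open>u l\<close>; as a closed condition it extends to the closure.\<close>
    have closed: "closed {x. P {l} x = ?R x}"
      by (intro closed_Collect_eq continuous_intros cont)
    have "{polycalc J T p \<xi> | p. p \<in> polys} \<subseteq> {x. P {l} x = ?R x}"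
    proof clarify
      fix p :: "'n mindex \<Rightarrow> complex" assume p: "p \<in> polys"
      define n where "n = norm (P {l} \<xi>)"
      define k where "k = polyfun p l"
      show "P {l} (polycalc J T p \<xi>) = ?R (polycalc J T p \<xi>)"
      proof (cases "P {l} \<xi> = 0")
        case True
        then show ?thesis
          unfolding P_poly[OF l p] by (simp add: u_def cscale_def linear_0[OF J'(1)])
      next
        case False
        then have n: "n \<noteq> 0" by (simp add: n_def)
        have \<xi>u: "P {l} \<xi> = n *\<^sub>R u l" using False by (simp add: u_def n_def)
        have uu: "inner (u l) (u l) = 1"
          using False by (simp add: u_def power2_norm_eq_inner[symmetric] power2_eq_square field_simps)
        have u0: "inner (J (u l)) (u l) = 0" "inner (u l) (J (u l)) = 0"
          using J'(2)[of "J (u l)" "u l"] by (simp_all add: J'(3) inner_commute)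
        show ?thesis
          unfolding P_poly[OF l p] cscale_def \<xi>u
          by (simp add: linear_cmul[OF J'(1)] inner_add_left uu u0 J'(2))
      qed
    qed
    then have "closure {polycalc J T p \<xi> | p. p \<in> polys} \<subseteq> {x. P {l} x = ?R x}"
      using closed by (rule closure_minimal)
    then show ?thesis unfolding \<xi> by blast
  qed
  have "atomic_system J P \<Lambda> K u"
  proof (rule atomic_system.intro)
    show "P {l} (u l) = u l" if "l \<in> \<Lambda>" for l
      using P_P[of "{l}" "{l}" \<xi>] by (simp add: u_def linear_cmul[OF bounded_linear.linear[OF BH(1)]])
    show "norm (u l) = 1" if "u l \<noteq> 0" for l
      using that by (simp add: u_def)
  qed (fact J BH P_P P_Un P_bound sep \<Lambda>(1) rank)+
  moreover have "P {l} (T j x) = cscale J (l $ j) (P {l} x)" if "l \<in> \<Lambda>" for l j x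
    using P_poly[OF that coord_poly_polys, of j x] that \<Lambda>(2) by (simp add: polycalc_coord polyfun_coord subset_iff)
  ultimately show ?thesis
    using that unfolding P_def by blast
qed

lemma bcl_cscale: "bcl J1 J2 X \<Longrightarrow> X (cscale J1 k x) = cscale J2 k (X x)"
  by (simp add: bcl_def cscale_def bounded_linear.linear linear_add linear_cmul)

theorem theorem6p5:
  fixes J1 :: "'a::{real_inner, complete_space} \<Rightarrow> 'a"
    and J2 :: "'b::{real_inner, complete_space} \<Rightarrow> 'b"
    and S :: "'n::finite \<Rightarrow> 'a \<Rightarrow> 'a"
    and T :: "'n \<Rightarrow> 'b \<Rightarrow> 'b"
    and \<Phi>S :: "(complex ^ 'n \<Rightarrow> complex) \<Rightarrow> 'a \<Rightarrow> 'a"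
    and \<Phi>T :: "(complex ^ 'n \<Rightarrow> complex) \<Rightarrow> 'b \<Rightarrow> 'b"
    and \<Lambda> :: "(complex ^ 'n) set"
  assumes "cstruct J1" and "cstruct J2"
    and "commuting_row_contraction J1 S" and "commuting_row_contraction J2 T"
    and "ac_calculus J1 S \<Phi>S" and "ac_calculus J2 T \<Phi>T"
    and "cyclic J1 S" and "cyclic J2 T"
    and "countable \<Lambda>" and "\<Lambda> \<subseteq> ball_d" and "interpolating \<Lambda>"
    and "v0 \<Lambda> \<subseteq> Ann \<Phi>S" and "Ann \<Phi>S = Ann \<Phi>T"
  shows "similar J1 S J2 T"
proof -
  have "\<forall>A. \<exists>\<phi>. \<phi> \<in> multipliers \<and> (\<forall>z\<in>\<Lambda>. \<phi> z = indicator A z)"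
  proof
    fix A :: "(complex ^ 'n) set"
    have "bounded ((indicator A :: complex ^ 'n \<Rightarrow> complex) ` \<Lambda>)"
      by (auto intro!: boundedI[where B = 1] simp: indicator_def)
    then show "\<exists>\<phi>. \<phi> \<in> multipliers \<and> (\<forall>z\<in>\<Lambda>. \<phi> z = indicator A z)"
      using \<open>interpolating \<Lambda>\<close> unfolding interpolating_def by blast
  qed
  from choice[OF this] obtain \<rho> where
    \<rho>: "\<And>A. \<rho> A \<in> multipliers" "\<And>A z. z \<in> \<Lambda> \<Longrightarrow> \<rho> A z = indicator A z" by blast
  define P where "P A = \<Phi>S (\<rho> A)" for A
  define Q where "Q A = \<Phi>T (\<rho> A)" for A
  have annT: "v0 \<Lambda> \<subseteq> Ann \<Phi>T" using assms(12,13) by simp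
  obtain K1 u where a: "atomic_system J1 P \<Lambda> K1 u"
    and PS: "\<And>l j x. l \<in> \<Lambda> \<Longrightarrow> P {l} (S j x) = cscale J1 (l $ j) (P {l} x)"
    unfolding P_def
    using calculus_atomic_system[OF assms(1,5,7,9-12), of \<rho>] \<rho> by blast
  obtain K2 v where b: "atomic_system J2 Q \<Lambda> K2 v"
    and QT: "\<And>l j x. l \<in> \<Lambda> \<Longrightarrow> Q {l} (T j x) = cscale J2 (l $ j) (Q {l} x)"
    unfolding Q_def
    using calculus_atomic_system[OF assms(2,6,8,9-11) annT, of \<rho>] \<rho> by blast
  interpret a: atomic_system J1 P \<Lambda> K1 u by fact
  interpret b: atomic_system J2 Q \<Lambda> K2 v by fact
  \<comment> \<open>Equality of the annihilators, tested on \<open>\<rho> {l}\<close>, makes the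
    nonzero atoms of both systems sit at the same points.\<close>
  have PQ: "(\<forall>x. P {l} x = 0) \<longleftrightarrow> (\<forall>x. Q {l} x = 0)" for l
    using assms(13) \<rho>(1)[of "{l}"] by (auto simp: Ann_def P_def Q_def set_eq_iff fun_eq_iff)
  have J0: "J1 0 = 0" "J2 0 = 0" by (rule linear_0[OF a.J_linear], rule linear_0[OF b.J_linear])
  have Pu: "u l = 0 \<longleftrightarrow> (\<forall>x. P {l} x = 0)" if "l \<in> \<Lambda>" for l
    using a.rank_one[OF that] a.P_u[OF that] J0 by (metis add.right_neutral scaleR_zero_right)
  have Qv: "v l = 0 \<longleftrightarrow> (\<forall>x. Q {l} x = 0)" if "l \<in> \<Lambda>" for l
    using b.rank_one[OF that] b.P_u[OF that] J0 by (metis add.right_neutral scaleR_zero_right)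
  have uv: "u l = 0 \<longleftrightarrow> v l = 0" if "l \<in> \<Lambda>" for l
    using Pu[OF that] Qv[OF that] PQ by simp
  obtain X where X: "bcl J2 J1 X" "\<And>l x. l \<in> \<Lambda> \<Longrightarrow> P {l} (X x) = rank_one_map J2 (v l) J1 (u l) (Q {l} x)"
    using intertwiner_exists[OF a b] by blast
  obtain Y where Y: "bcl J1 J2 Y" "\<And>l x. l \<in> \<Lambda> \<Longrightarrow> Q {l} (Y x) = rank_one_map J1 (u l) J2 (v l) (P {l} x)"
    using intertwiner_exists[OF b a] by blast
  have "X (Y x) = x" for x
    by (rule a.separate)
      (simp add: X(2) Y(2) a.rank_one_map_inverse uv b.u_norm assms(2))
  moreover have "Y (X x) = x" for x
    by (rule b.separate)
      (simp add: X(2) Y(2) b.rank_one_map_inverse uv a.u_norm assms(1))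
  moreover have "X (T j x) = S j (X x)" for j x
  proof (rule a.separate)
    fix l assume l: "l \<in> \<Lambda>"
    have X': "X (cscale J2 k y) = cscale J1 k (X y)" for k y by (rule bcl_cscale[OF X(1)])
    have Q': "Q {l} (cscale J2 k y) = cscale J2 k (Q {l} y)" for k y
      using b.P_linear b.P_J by (intro bcl_cscale) (auto simp: bcl_def)
    have P': "P {l} (cscale J1 k y) = cscale J1 k (P {l} y)" for k y
      using a.P_linear a.P_J by (intro bcl_cscale) (auto simp: bcl_def)
    \<comment> \<open>\<open>P {l} (X y)\<close> depends on \<open>y\<close> only through
      \<open>Q {l} y\<close>, where \<open>T j\<close> acts as the scalar \<open>l $ j\<close>;
      \<open>S j\<close> acts by the same scalar under \<open>P {l}\<close>.\<close>
    have "P {l} (X (T j x)) = P {l} (X (cscale J2 (l $ j) x))"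
      unfolding X(2)[OF l] Q' QT[OF l] ..
    also have "\<dots> = P {l} (S j (X x))"
      unfolding X' P' PS[OF l] ..
    finally show "P {l} (X (T j x)) = P {l} (S j (X x))" .
  qed
  ultimately show ?thesis
    using X(1) Y(1) unfolding similar_def by (intro exI[of _ X] exI[of _ Y]) (auto simp: fun_eq_iff)
qed

end
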